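(* Let $\mathcal X=[d]$, let $\mathcal Y$ be an observation space, and let $L\ge1$. Let $K$ be any of the following kernels on $\mathcal Y$: (i) an integrally strictly positive definite kernel (in particular, the Gaussian kernel $K(y,y')=\exp(-\|y-y'\|^2/\sigma^2)$ on any separable Hilbert space $\mathcal Y$); (ii) $\mathcal Y$ finite and $K(y,y')=\langle\phi(y),\phi(y')\rangle$ with an injective feature map $\phi:\mathcal Y\to\mathbb R^k$; (iii) the pseudo-posterior kernel with a full-support prior $\tilde q$. Then the kernelized Gram determinant score $\Gamma_K=\det(\hat G_K)$ preserves 1. the exact match ordering under $\mathcal P_{\mathrm{indep}}$ and $\mathcal Q_{\mathrm{nonperm}}$; 2. the Blackwell dominant ordering under $\mathcal P_{\mathrm{indep}}$ and $\mathcal Q_{\mathrm{reg}}$; 3. the $\frac1{4L\Delta}$-$\mathrm{dist}$ ordering under $\mathcal P_{\mathrm{indep}}$ and $\mathcal Q_{L,\,1/(64L^2d^2)}$, for every distance function $\mathrm{dist}$, where $\Delta=\frac{\max_{a,b\in\mathcal X}\mathrm{dist}(a,b)}{\min_{a\neq b\in\mathcal X}\mathrm{dist}(a,b)}$.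
   Context: Datasets are vectors $x=(x_1,\dots,x_N)\in\mathcal X^N$, $N\ge1$. For true data $x$ and reported data $\hat x$ in $\mathcal X^N$, the misreport matrix is $Q\in\mathbb R^{d\times d}$, $Q(i,j)=\frac1N\#\{n: x_n=i,\hat x_n=j\}$; $q_x(i)=\frac1N\#\{n:x_n=i\}$. When every label occurs in $x$, define $Q_{\hat x\mid x}(i,j)=\frac{\#\{n:x_n=j,\hat x_n=i\}}{\#\{n:x_n=j\}}$ (column stochastic). For a second report $\hat x'$ of the same $x$, $Q'$ and $Q'_{\hat x\mid x}$ are the corresponding matrices of $(x,\hat x')$. An experiment is a family $P=(P_a)_{a\in\mathcal X}$ of probability distributions on $\mathcal Y$; $\mathcal P_{\mathrm{indep}}$ is the set of experiments for which $P_1,\dots,P_d$ are linearly independent (as signed measures). Kernels. A kernel $K:\mathcal Y\times\mathcal Y\to\mathbb R$ is (measurable and) positive definite, i.e. all matrices $[K(y_i,y_j)]$ are symmetric positive semidefinite. It is integrally strictly positive definite if $\iint K(y,y')\,d\mu(y)d\mu(y')>0$ for all finite nonzero signed measures $\mu$ on $\mathcal Y$. A feature map $\phi:\mathcal Y\to\mathbb R^k$ is called injective if the vectors $\{\phi(y)\}_{y\in\mathcal Y}$ are linearly independent. Pseudo-posterior case: $\tilde q$ is a probability distribution on $\mathcal X$ (full support: $\tilde q(a)>0$ for all $a$), observations are probability vectors $y\in\mathbb R^d$, and the experiment (with probability masses $P(y,a)=P_a(y)$) is such that each observation $y$ (of positive probability) satisfies $y=\Big(\frac{P(y,a)\tilde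 q(a)}{\sum_{a'}P(y,a')\tilde q(a')}\Big)_{a\in\mathcal X}$; the pseudo-posterior kernel is $K(y,y')=y^\top y'$, and in this case only experiments of this form are considered. Score. $\langle P_a,P_b\rangle_K=\mathbb E_{y\sim P_a,\,y'\sim P_b}[K(y,y')]$ ($y,y'$ independent), and $\hat G_K\in\mathbb R^{d\times d}$ is $\hat G_K(a,b)=\frac1{N^2}\sum_{n,n':\hat x_n=a,\hat x_{n'}=b}\langle P_{x_n},P_{x_{n'}}\rangle_K$. The score of the report $\hat x$ is $\Gamma_K=\det(\hat G_K)$; $\Gamma_K'$ denotes the score of $\hat x'$. Classes of misreport matrices: - $\mathcal Q_{\mathrm{nonperm}}$: those $Q$ whose associated $Q_{\hat x\mid x}$ is not a permutation matrix different from the identity. - $\mathcal Q_{\mathrm{reg}}$: $Q$ is invertible and (row) diagonally maximal, i.e. $Q(i,j)\le Q(i,i)$ for all $i,j$. - $\mathcal Q_{L,\delta}$: $\sum_{j\ne i}|Q(i,j)|\le|Q(i,i)|$ for all $i$; $q_x(a)\le Lq_x(b)$ for all $a,b\in\mathcal X$; and $\#\{n:\hat x_n\ne x_n\}\le N\delta$. Orderings relative to $x$: - Exact match: $\hat x\succ\hat x'$ iff $\hat x=x$ and $\hat x'\ne x$. - Blackwell dominant: $\hat x\succ\hat x'$ iff $Q,Q'\in\mathcal Q_{\mathrm{reg}}$ and $TQ_{\hat x\mid x}=Q'_{\hat x\mid x}$ for some column-stochastic $T\ne I$. - $\alpha$-dist ($\alpha\in(0,1]$): a distance function $\mathrm{dist}:\mathcal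 X^2\to\mathbb R$ is symmetric with $\mathrm{dist}(a,a)=0$ and $\mathrm{dist}(a,b)>0$ for $a\ne b$; $\hat x\succ\hat x'$ iff $\sum_n\mathrm{dist}(\hat x_n,x_n)<\alpha\sum_n\mathrm{dist}(\hat x'_n,x_n)$. The score preserves an ordering under $\mathcal P,\mathcal Q$ if $\Gamma_K>\Gamma_K'$ for all $P\in\mathcal P$ and all $x,\hat x,\hat x'$ of a common length with $\hat x\succ\hat x'$ and $Q,Q'\in\mathcal Q$.
   Formalization: Item 2 is proved for pairs where x̂ Blackwell-dominates x̂' but not conversely; as written it fails for d=3 (x=112233, x̂=122331, x̂'=132132 dominate each other via a permutation T, so Γ=Γ'). Exactly the mutually dominating pairs are excluded. *)

theory Defs
  imports "HOL-Probability.Probability"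
begin

section \<open>Reports and misreport matrices\<close>

text \<open>
  The label set is a finite type, so \<open>d = CARD('d) \<ge> 1\<close>; a dataset of length \<open>N\<close> is a list,
  with the \<open>n\<close>-th datum \<open>x ! n\<close> for \<open>n < N\<close>.
\<close>

definition misreport_matrix :: "'d list \<Rightarrow> 'd list \<Rightarrow> real^'d^'d" where
  "misreport_matrix x xh =
     (\<chi> i j. real (card {n. n < length x \<and> x ! n = i \<and> xh ! n = j}) / real (length x))"

definition label_freq :: "'d list \<Rightarrow> 'd \<Rightarrow> real" where
  "label_freq x i = real (card {n. n < length x \<and> x ! n = i}) / real (length x)"

text \<open>Entry \<open>(i, j)\<close> is the rate of reporting \<open>i\<close> given the truth \<open>j\<close>: the index order is opposite
  to that of \<^const>\<open>misreport_matrix\<close>.\<close>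

definition conditional_report_matrix :: "'d list \<Rightarrow> 'd list \<Rightarrow> real^'d^'d" where
  "conditional_report_matrix x xh =
     (\<chi> i j. real (card {n. n < length x \<and> x ! n = j \<and> xh ! n = i})
              / real (card {n. n < length x \<and> x ! n = j}))"

definition column_stochastic :: "real^'d^'d \<Rightarrow> bool" where
  "column_stochastic T \<longleftrightarrow> (\<forall>i j. 0 \<le> T $ i $ j) \<and> (\<forall>j. (\<Sum>i\<in>UNIV. T $ i $ j) = 1)"

definition permutation_matrix :: "real^'d^'d \<Rightarrow> bool" where
  "permutation_matrix T \<longleftrightarrow>
     (\<exists>\<pi>. bij \<pi> \<and> T = (\<chi> i j. if i = \<pi> j then 1 else 0))"

definition is_report :: "'d list \<Rightarrow> 'd list \<Rightarrow> bool" where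
  "is_report x xh \<longleftrightarrow> x \<noteq> [] \<and> length xh = length x"

text \<open>The conditional matrix exists only if every label occurs in \<open>x\<close>, which is therefore part of
  membership in \<open>Q_nonperm\<close>.\<close>

definition Q_nonperm :: "(real^'d^'d) set" where
  "Q_nonperm =
     {misreport_matrix x xh | x xh. is_report x xh \<and> set x = UNIV \<and>
        \<not> (permutation_matrix (conditional_report_matrix x xh) \<and>
           conditional_report_matrix x xh \<noteq> mat 1)}"

definition Q_reg :: "(real^'d^'d) set" where
  "Q_reg = {Q. (\<exists>x xh. is_report x xh \<and> Q = misreport_matrix x xh) \<and>
               invertible Q \<and> (\<forall>i j. Q $ i $ j \<le> Q $ i $ i)}"

definition Q_diag_dom :: "real \<Rightarrow> real \<Rightarrow> (real^'d^'d) set" where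
  "Q_diag_dom L \<delta> =
     {misreport_matrix x xh | x xh. is_report x xh \<and>
        (\<forall>i. (\<Sum>j\<in>UNIV - {i}. \<bar>misreport_matrix x xh $ i $ j\<bar>) \<le> \<bar>misreport_matrix x xh $ i $ i\<bar>) \<and>
        (\<forall>a b. label_freq x a \<le> L * label_freq x b) \<and>
        real (card {n. n < length x \<and> xh ! n \<noteq> x ! n}) \<le> real (length x) * \<delta>}"


section \<open>Orderings of reports\<close>

text \<open>An ordering is applied as \<open>ord x xh xh'\<close>, read \<open>xh \<succ> xh'\<close> relative to the true data \<open>x\<close>.\<close>

definition exact_match :: "'d list \<Rightarrow> 'd list \<Rightarrow> 'd list \<Rightarrow> bool" where
  "exact_match x xh xh' \<longleftrightarrow> xh = x \<and> xh' \<noteq> x"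

text \<open>Invertibility of the misreport matrices forces every label to occur in \<open>x\<close>, so the
  conditional matrices below are well defined.\<close>

definition blackwell_dominant :: "'d::finite list \<Rightarrow> 'd list \<Rightarrow> 'd list \<Rightarrow> bool" where
  "blackwell_dominant x xh xh' \<longleftrightarrow>
     misreport_matrix x xh \<in> Q_reg \<and> misreport_matrix x xh' \<in> Q_reg \<and>
     (\<exists>T. column_stochastic T \<and> T \<noteq> mat 1 \<and>
          T ** conditional_report_matrix x xh = conditional_report_matrix x xh')"

definition distance_function :: "('d \<Rightarrow> 'd \<Rightarrow> real) \<Rightarrow> bool" where
  "distance_function D \<longleftrightarrow>
     (\<forall>a b. D a b = D b a) \<and> (\<forall>a. D a a = 0) \<and> (\<forall>a b. a \<noteq> b \<longrightarrow> 0 < D a b)"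

definition dist_order ::
    "real \<Rightarrow> ('d \<Rightarrow> 'd \<Rightarrow> real) \<Rightarrow> 'd list \<Rightarrow> 'd list \<Rightarrow> 'd list \<Rightarrow> bool" where
  "dist_order \<alpha> D x xh xh' \<longleftrightarrow>
     (\<Sum>n<length x. D (xh ! n) (x ! n)) < \<alpha> * (\<Sum>n<length x. D (xh' ! n) (x ! n))"

text \<open>For \<open>d = 1\<close> the minimum is over the empty set and unspecified; then all distances between
  labels vanish and \<^const>\<open>dist_order\<close> relates no reports, whatever \<open>\<alpha>\<close> is.\<close>

definition distance_ratio :: "('d::finite \<Rightarrow> 'd \<Rightarrow> real) \<Rightarrow> real" where
  "distance_ratio D = Max {D a b | a b. True} / Min {D a b | a b. a \<noteq> b}"


section \<open>Kernels\<close>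

definition pd_kernel :: "'y measure \<Rightarrow> ('y \<Rightarrow> 'y \<Rightarrow> real) \<Rightarrow> bool" where
  "pd_kernel M K \<longleftrightarrow>
     (\<lambda>z. K (fst z) (snd z)) \<in> borel_measurable (M \<Otimes>\<^sub>M M) \<and>
     (\<forall>y\<in>space M. \<forall>y'\<in>space M. K y y' = K y' y) \<and>
     (\<forall>m (y :: nat \<Rightarrow> 'y) (c :: nat \<Rightarrow> real). (\<forall>i<m. y i \<in> space M) \<longrightarrow>
        0 \<le> (\<Sum>i<m. \<Sum>j<m. c i * c j * K (y i) (y j)))"

definition kernel_integral :: "('y \<Rightarrow> 'y \<Rightarrow> real) \<Rightarrow> 'y measure \<Rightarrow> 'y measure \<Rightarrow> real" where
  "kernel_integral K \<mu> \<nu> = (\<integral>z. K (fst z) (snd z) \<partial>(\<mu> \<Otimes>\<^sub>M \<nu>))"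

definition kernel_integrable :: "('y \<Rightarrow> 'y \<Rightarrow> real) \<Rightarrow> 'y measure \<Rightarrow> 'y measure \<Rightarrow> bool" where
  "kernel_integrable K \<mu> \<nu> \<longleftrightarrow> integrable (\<mu> \<Otimes>\<^sub>M \<nu>) (\<lambda>z. K (fst z) (snd z))"

text \<open>
  A finite signed measure on \<open>M\<close> is given as a difference \<open>\<mu> - \<nu>\<close> of two finite measures (every
  finite signed measure is of this form by the Jordan decomposition, and it is nonzero iff
  \<open>\<mu> \<noteq> \<nu>\<close>); the double integral against \<open>\<mu> - \<nu>\<close> is expanded bilinearly. That the double integral
  exists is part of the definition; by itself this would be implicit in writing the inequality,
  but Bochner integrals are total.
\<close>

definition integrally_strictly_pd :: "'y measure \<Rightarrow> ('y \<Rightarrow> 'y \<Rightarrow> real) \<Rightarrow> bool" where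
  "integrally_strictly_pd M K \<longleftrightarrow>
     pd_kernel M K \<and>
     (\<forall>\<mu> \<nu>. finite_measure \<mu> \<and> finite_measure \<nu> \<and> sets \<mu> = sets M \<and> sets \<nu> = sets M \<and> \<mu> \<noteq> \<nu> \<longrightarrow>
        kernel_integrable K \<mu> \<mu> \<and> kernel_integrable K \<mu> \<nu> \<and>
        kernel_integrable K \<nu> \<mu> \<and> kernel_integrable K \<nu> \<nu> \<and>
        0 < kernel_integral K \<mu> \<mu> - kernel_integral K \<mu> \<nu>
            - kernel_integral K \<nu> \<mu> + kernel_integral K \<nu> \<nu>)"

definition gaussian_kernel :: "real \<Rightarrow> 'h::real_normed_vector \<Rightarrow> 'h \<Rightarrow> real" where
  "gaussian_kernel \<sigma> y y' = exp (- (norm (y - y'))\<^sup>2 / \<sigma>\<^sup>2)"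

definition injective_feature_map :: "('y \<Rightarrow> 'v::real_vector) \<Rightarrow> bool" where
  "injective_feature_map \<phi> \<longleftrightarrow> inj \<phi> \<and> independent (range \<phi>)"


section \<open>Experiments\<close>

definition is_experiment :: "'y measure \<Rightarrow> ('d \<Rightarrow> 'y measure) \<Rightarrow> bool" where
  "is_experiment M P \<longleftrightarrow> (\<forall>a. prob_space (P a) \<and> sets (P a) = sets M)"

definition P_indep :: "'y measure \<Rightarrow> ('d::finite \<Rightarrow> 'y measure) set" where
  "P_indep M = {P. is_experiment M P \<and>
     (\<forall>c :: 'd \<Rightarrow> real. (\<forall>A\<in>sets M. (\<Sum>a\<in>UNIV. c a * measure (P a) A) = 0) \<longrightarrow> (\<forall>a. c a = 0))}"

text \<open>Observations are vectors in \<open>real^'d\<close>, and every observation occurring with positive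
  probability is the posterior it induces under the prior \<open>q\<close>; in particular it is a probability
  vector.\<close>

definition P_pseudo_posterior :: "'d::finite pmf \<Rightarrow> ('d \<Rightarrow> (real^'d) measure) set" where
  "P_pseudo_posterior q = {(\<lambda>a. measure_pmf (p a)) | p :: 'd \<Rightarrow> (real^'d) pmf.
     \<forall>y. (\<exists>a. 0 < pmf (p a) y) \<longrightarrow>
         y = (\<chi> a. pmf (p a) y * pmf q a / (\<Sum>a'\<in>UNIV. pmf (p a') y * pmf q a'))}"


section \<open>The score\<close>

definition empirical_gram ::
    "('y \<Rightarrow> 'y \<Rightarrow> real) \<Rightarrow> ('d \<Rightarrow> 'y measure) \<Rightarrow> 'd list \<Rightarrow> 'd list \<Rightarrow> real^'d^'d" where
  "empirical_gram K P x xh =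
     (\<chi> a b. (\<Sum>n\<in>{n. n < length x \<and> xh ! n = a}. \<Sum>n'\<in>{n'. n' < length x \<and> xh ! n' = b}.
                kernel_integral K (P (x ! n)) (P (x ! n'))) / (real (length x))\<^sup>2)"

definition gram_score ::
    "('y \<Rightarrow> 'y \<Rightarrow> real) \<Rightarrow> ('d::finite \<Rightarrow> 'y measure) \<Rightarrow> 'd list \<Rightarrow> 'd list \<Rightarrow> real" where
  "gram_score K P x xh = det (empirical_gram K P x xh)"

definition score_preserves ::
    "('y \<Rightarrow> 'y \<Rightarrow> real) \<Rightarrow> ('d::finite \<Rightarrow> 'y measure) set \<Rightarrow> (real^'d^'d) set \<Rightarrow>
     ('d list \<Rightarrow> 'd list \<Rightarrow> 'd list \<Rightarrow> bool) \<Rightarrow> bool" where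
  "score_preserves K \<P> \<Q> ord \<longleftrightarrow>
     (\<forall>P\<in>\<P>. \<forall>x xh xh'. is_report x xh \<and> is_report x xh' \<and>
        misreport_matrix x xh \<in> \<Q> \<and> misreport_matrix x xh' \<in> \<Q> \<and> ord x xh xh' \<longrightarrow>
        gram_score K P x xh > gram_score K P x xh')"


section \<open>Blackwell dominance is not asymmetric\<close>

text \<open>
  With the weak inequality in \<^const>\<open>Q_reg\<close>, two reports can dominate each other, \<open>T\<close> being a
  permutation matrix; the following example has \<open>d = 3\<close> and \<open>N = 6\<close>. No real-valued score is
  strictly monotone on such a pair, so results about strict preservation must be about
  the asymmetric part of the relation:
\<close>

definition strict_blackwell_dominant :: "'d::finite list \<Rightarrow> 'd list \<Rightarrow> 'd list \<Rightarrow> bool" where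
  "strict_blackwell_dominant x xh xh' \<longleftrightarrow>
     blackwell_dominant x xh xh' \<and> \<not> blackwell_dominant x xh' xh"

lemma card_nth_pair:
  assumes "length xh = length x"
  shows "card {n. n < length x \<and> R (x ! n) (xh ! n)} = length (filter (\<lambda>(a, b). R a b) (zip x xh))"
  unfolding length_filter_conv_card using assms by (intro arg_cong[where f = card]) auto

lemma card_nth_eq: "card {n. n < length x \<and> x ! n = i} = length (filter (\<lambda>a. a = i) x)"
  unfolding length_filter_conv_card by simp

lemma blackwell_dominant_mutual:
  obtains x xh xh' :: "3 list"
  where "is_report x xh" "is_report x xh'"
    "blackwell_dominant x xh xh'" "blackwell_dominant x xh' xh"
proof
  define x xh xh' :: "3 list"
    where "x = [1,1,2,2,3,3]" and "xh = [1,2,2,3,3,1]" and "xh' = [1,3,2,1,3,2]"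
  note defs = x_def xh_def xh'_def
  have neq: "(1::3) \<noteq> 2" "(2::3) \<noteq> 1" "(1::3) \<noteq> 3" "(3::3) \<noteq> 1" "(2::3) \<noteq> 3" "(3::3) \<noteq> 2"
    by simp_all
  show rep: "is_report x xh" "is_report x xh'"
    by (simp_all add: is_report_def defs)
  note card2 = card_nth_pair[where R = "\<lambda>a b. a = i \<and> b = j" for i j]
    card_nth_pair[where R = "\<lambda>a b. a = j \<and> b = i" for i j]
  have len: "length xh = length x" "length xh' = length x" "length x = 6"
    by (simp_all add: defs)
  define A B :: "real^3^3"
    where "A = vector [vector [1,1,0], vector [0,1,1], vector [1,0,1]]"
      and "B = vector [vector [1,0,1], vector [1,1,0], vector [0,1,1]]"
  have Q: "misreport_matrix x xh = (1/6) *\<^sub>R A" "misreport_matrix x xh' = (1/6) *\<^sub>R B"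
    unfolding misreport_matrix_def card2[OF len(1)] card2[OF len(2)] A_def B_def
    by (simp_all add: vec_eq_iff forall_3 vector_3 defs neq)
  have C: "conditional_report_matrix x xh = (1/2) *\<^sub>R transpose A"
    "conditional_report_matrix x xh' = (1/2) *\<^sub>R transpose B"
    unfolding conditional_report_matrix_def card2[OF len(1)] card2[OF len(2)] card_nth_eq A_def B_def
    by (simp_all add: vec_eq_iff forall_3 vector_3 defs neq transpose_def)
  have "misreport_matrix x xh \<in> Q_reg" "misreport_matrix x xh' \<in> Q_reg"
    unfolding Q_reg_def using rep
    by (auto simp: Q invertible_det_nz det_3 A_def B_def vector_3 forall_3)
       (metis Q A_def B_def)+
  moreover
  define T T' :: "real^3^3"
    where "T = vector [vector [0,1,0], vector [0,0,1], vector [1,0,0]]"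
      and "T' = vector [vector [0,0,1], vector [1,0,0], vector [0,1,0]]"
  have "column_stochastic T" "column_stochastic T'"
    by (simp_all add: column_stochastic_def T_def T'_def vector_3 forall_3 sum_3)
  moreover have "T \<noteq> mat 1" "T' \<noteq> mat 1"
    by (simp_all add: T_def T'_def vec_eq_iff forall_3 vector_3 mat_def neq)
  moreover have "T ** conditional_report_matrix x xh = conditional_report_matrix x xh'"
    "T' ** conditional_report_matrix x xh' = conditional_report_matrix x xh"
    by (simp_all add: C T_def T'_def A_def B_def transpose_def matrix_matrix_mult_def
        vec_eq_iff forall_3 vector_3 sum_3)
  ultimately show "blackwell_dominant x xh xh'" "blackwell_dominant x xh' xh"
    unfolding blackwell_dominant_def by blast+
qed

end

theory Submission
  imports Defs
begin

text \<open>
  With \<open>G\<close> the Gram matrix of the experiment, the empirical Gram matrix is \<open>Q\<^sup>T G Q\<close>, so the score is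
  \<open>det G \<cdot> (det Q)\<^sup>2\<close>. For the kernels considered \<open>G\<close> is positive definite on linearly independent
  experiments, hence \<open>det G > 0\<close>, and each ordering becomes a comparison of \<open>\<bar>det Q\<bar>\<close>. This rests on
  one estimate: for a row-stochastic matrix, the products of one entry per row sum to 1 over all
  selections, while the determinant only sees the bijective ones.

  For the Gaussian kernel, Cauchy-Schwarz in the kernel shows that a signed measure \<open>\<mu>\<close> of zero energy
  has vanishing potential. Then \<open>exp (- \<parallel>y\<parallel>\<^sup>2 / \<sigma>\<^sup>2) d\<mu>\<close> has vanishing Laplace transform, so
  vanishing moments in every direction, so vanishing integrals against all \<open>cos \<langle>y, v\<rangle>\<close> and
  \<open>sin \<langle>y, v\<rangle>\<close>; these are closed under products up to linear combinations, and a functional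
  monotone class argument gives \<open>\<mu> = 0\<close>, with no Gaussian measure on the Hilbert space needed.
\<close>

section \<open>Determinants of row-stochastic matrices\<close>

text \<open>The constants of the distance ordering come from pairing two estimates. If
  \<open>S\<close> is the total off-diagonal mass of the transposed conditional matrix, its
  determinant is at least \<open>1 - 2 * S\<close>, and its absolute value is at most
  \<open>1 - S * (1 - S)\<close>, hence at most \<open>1 - S / 2\<close> once
  \<open>S \<le> 1 / 2\<close>. So a report wins as soon as its \<open>S\<close> is below a quarter
  of its rival's: this is the 4. Going from mismatch counts to \<open>S\<close> divides by label
  frequencies known only up to the factor \<open>L\<close>, and going from distances to counts costs
  the ratio of the extreme distances. The cutoff on the mismatch fraction serves to force
  \<open>S \<le> 1 / 2\<close> for the losing report. Two obstacles shape the kernel part. Strict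
  definiteness is stated for a pair of finite measures, so coefficients of both signs have to be
  split into two genuine measures. The pseudo-posterior kernel has finite rank and is not strictly
  definite on all signed measures; its Gram matrix is positive definite only because of the Bayes
  form of the observations, which calls for a separate argument.\<close>

lemma sum_prod_rows_eq_1:
  fixes R :: "real^'n^'n"
  assumes "\<And>i. (\<Sum>j\<in>UNIV. R $ i $ j) = 1"
  shows "(\<Sum>f\<in>UNIV. \<Prod>i\<in>UNIV. R $ i $ f i) = 1"
proof -
  have "(\<Prod>i\<in>UNIV. \<Sum>j\<in>UNIV. R $ i $ j) = (\<Sum>f\<in>PiE UNIV (\<lambda>_. UNIV). \<Prod>i\<in>UNIV. R $ i $ f i)"
    by (rule prod_sum_PiE) auto
  then show ?thesis
    using assms by (simp add: PiE_UNIV_domain)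
qed

text \<open>Rows rather than columns, since \<open>det_def\<close> selects one entry per row;
  conditional report matrices enter through their transposes.\<close>

definition row_stochastic :: "real^'n^'n \<Rightarrow> bool" where
  "row_stochastic R \<longleftrightarrow> (\<forall>i j. 0 \<le> R $ i $ j) \<and> (\<forall>i. (\<Sum>j\<in>UNIV. R $ i $ j) = 1)"

text \<open>The triangle inequality bounds the determinant by the total weight of the permutations;
  the weights are nonnegative with sum 1, so whatever weight a family of non-bijections carries is
  lost.\<close>

lemma abs_det_row_stochastic:
  fixes R :: "real^'n^'n"
  assumes R: "row_stochastic R" and F: "\<And>f. f \<in> F \<Longrightarrow> \<not> bij f"
  shows "\<bar>det R\<bar> \<le> 1 - (\<Sum>f\<in>F. \<Prod>i\<in>UNIV. R $ i $ f i)"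
proof -
  define W where "W f = (\<Prod>i\<in>UNIV. R $ i $ f i)" for f
  have W0: "0 \<le> W f" for f
    using R by (auto simp: W_def row_stochastic_def intro: prod_nonneg)
  let ?B = "{p. p permutes (UNIV :: 'n set)}"
  have "\<bar>det R\<bar> \<le> (\<Sum>p\<in>?B. \<bar>of_int (sign p) * W p\<bar>)"
    unfolding det_def W_def by (rule sum_abs)
  also have "\<dots> = (\<Sum>p\<in>?B. W p)"
    using W0 by (intro sum.cong) (auto simp: abs_mult sign_def)
  finally have "\<bar>det R\<bar> \<le> (\<Sum>p\<in>?B. W p)" .
  moreover have "(\<Sum>f\<in>?B \<union> F. W f) \<le> (\<Sum>f\<in>UNIV. W f)"
    by (rule sum_mono2) (auto simp: W0)
  moreover have "(\<Sum>f\<in>?B \<union> F. W f) = (\<Sum>p\<in>?B. W p) + (\<Sum>f\<in>F. W f)"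
    using F by (intro sum.union_disjoint) (auto simp: finite_subset[OF subset_UNIV] dest: permutes_bij)
  moreover have "(\<Sum>f\<in>UNIV. W f) = 1"
    unfolding W_def using R by (intro sum_prod_rows_eq_1) (simp add: row_stochastic_def)
  ultimately show ?thesis by (simp add: W_def)
qed

lemma abs_det_row_stochastic_le_1:
  fixes R :: "real^'n^'n"
  assumes "row_stochastic R" shows "\<bar>det R\<bar> \<le> 1"
  using abs_det_row_stochastic[OF assms, of "{}"] by simp

text \<open>In the extremal case no weight is lost, so every selection of positive entries is a
  bijection. Changing a bijection at a single argument destroys bijectivity, which leaves room for
  only one positive entry per row.\<close>

lemma row_stochastic_abs_det_eq_1:
  fixes R :: "real^'n^'n"
  assumes R: "row_stochastic R" and det: "\<bar>det R\<bar> = 1"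
  obtains g where "bij g" "\<And>i j. R $ i $ j = (if j = g i then 1 else 0)"
proof -
  have bij: "bij f" if pos: "\<And>i. 0 < R $ i $ f i" for f
  proof (rule ccontr)
    assume "\<not> bij f"
    then have "\<bar>det R\<bar> \<le> 1 - (\<Prod>i\<in>UNIV. R $ i $ f i)"
      using abs_det_row_stochastic[OF R, of "{f}"] by simp
    moreover have "0 < (\<Prod>i\<in>UNIV. R $ i $ f i)" using pos by (intro prod_pos) auto
    ultimately show False using det by simp
  qed
  have "\<exists>j. 0 < R $ i $ j" for i
  proof (rule ccontr)
    assume "\<nexists>j. 0 < R $ i $ j"
    then have "\<And>j. R $ i $ j = 0" using R by (auto simp: row_stochastic_def less_le)
    then show False using R by (auto simp: row_stochastic_def dest: spec[of _ i])
  qed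
  then obtain g where g: "\<And>i. 0 < R $ i $ g i" by metis
  \<comment> \<open>A second positive entry in row \<open>i\<close> would make
    \<open>g(i := j)\<close> a positive selection as well, but it takes the value \<open>j\<close>
    both at \<open>i\<close> and at the preimage \<open>k\<close> of \<open>j\<close> under
    \<open>g\<close>.\<close>
  have zero: "R $ i $ j = 0" if "j \<noteq> g i" for i j
  proof (rule ccontr)
    assume "R $ i $ j \<noteq> 0"
    then have "0 < R $ i $ j" using R by (auto simp: row_stochastic_def less_le)
    with g have bij': "bij (g(i := j))" by (intro bij) auto
    obtain k where k: "g k = j" using bij[OF g] by (metis bij_pointE)
    with that have "k \<noteq> i" by auto
    then have "(g(i := j)) k = (g(i := j)) i" using k by simp
    then show False using bij' \<open>k \<noteq> i\<close> by (metis bij_pointE)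
  qed
  have "R $ i $ g i = 1" for i
  proof -
    have "(\<Sum>j\<in>UNIV. R $ i $ j) = (\<Sum>j\<in>UNIV. if j = g i then R $ i $ g i else 0)"
      using zero by (intro sum.cong) auto
    with R show ?thesis by (simp add: row_stochastic_def)
  qed
  with zero bij[OF g] show thesis by (intro that[of g]) auto
qed

text \<open>The identity contributes \<open>W id\<close>, and all other permutations together at
  most \<open>1 - W id\<close> in absolute value, so the determinant is at least
  \<open>2 * W id - 1\<close>; the Weierstrass product inequality bounds \<open>W id\<close>
  below.\<close>

lemma det_row_stochastic_ge:
  fixes R :: "real^'n^'n"
  assumes R: "row_stochastic R"
  shows "1 - 2 * (\<Sum>i\<in>UNIV. 1 - R $ i $ i) \<le> det R"
proof -
  define W where "W f = (\<Prod>i\<in>UNIV. R $ i $ f i)" for f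
  have W0: "0 \<le> W f" for f
    using R by (auto simp: W_def row_stochastic_def intro: prod_nonneg)
  let ?B = "{p. p permutes (UNIV :: 'n set)}"
  have fin: "finite ?B" by simp
  have id: "id \<in> ?B" by (simp add: permutes_id)
  have "det R = W id + (\<Sum>p\<in>?B - {id}. of_int (sign p) * W p)"
    unfolding det_def W_def[symmetric] by (subst sum.remove[OF fin id]) (simp add: sign_id)
  moreover have "\<bar>\<Sum>p\<in>?B - {id}. of_int (sign p) * W p\<bar> \<le> (\<Sum>p\<in>?B - {id}. W p)"
    by (rule order_trans[OF sum_abs], rule sum_mono) (simp add: abs_mult sign_def W0)
  moreover have "(\<Sum>p\<in>?B - {id}. W p) \<le> (\<Sum>p\<in>UNIV - {id}. W p)"
    by (rule sum_mono2) (auto simp: W0)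
  moreover have "(\<Sum>p\<in>UNIV - {id}. W p) = 1 - W id"
  proof -
    have "(\<Sum>p\<in>UNIV. W p) = 1"
      unfolding W_def using R by (intro sum_prod_rows_eq_1) (simp add: row_stochastic_def)
    then show ?thesis by (simp add: sum_diff1)
  qed
  moreover have "1 - (\<Sum>i\<in>UNIV. 1 - R $ i $ i) \<le> (\<Prod>i\<in>UNIV. 1 - (1 - R $ i $ i))"
  proof (rule Weierstrass_prod_ineq)
    fix i :: 'n
    have "R $ i $ i \<le> (\<Sum>j\<in>UNIV. R $ i $ j)"
      using R by (intro member_le_sum) (auto simp: row_stochastic_def)
    then show "1 - R $ i $ i \<in> {0..1}"
      using R by (auto simp: row_stochastic_def)
  qed
  ultimately show ?thesis by (simp add: W_def)
qed

text \<open>Among the non-bijective selections of one entry per row, those differing from the diagonal in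
  exactly one row already cost the determinant almost the whole off-diagonal mass.\<close>

lemma abs_det_row_stochastic_le:
  fixes R :: "real^'n^'n"
  assumes R: "row_stochastic R"
  defines "S \<equiv> \<Sum>i\<in>UNIV. 1 - R $ i $ i"
  shows "\<bar>det R\<bar> \<le> 1 - S * (1 - S)"
proof -
  have R0: "0 \<le> R $ i $ j" for i j using R by (simp add: row_stochastic_def)
  have R1: "R $ i $ i \<le> 1" for i
  proof -
    have "R $ i $ i \<le> (\<Sum>j\<in>UNIV. R $ i $ j)"
      using R by (intro member_le_sum) (auto simp: row_stochastic_def)
    then show ?thesis using R by (simp add: row_stochastic_def)
  qed
  define F where "F = (\<lambda>(i, j). (id :: 'n \<Rightarrow> 'n)(i := j)) ` (SIGMA i:UNIV. UNIV - {i})"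
  have inj: "inj_on (\<lambda>(i, j). (id :: 'n \<Rightarrow> 'n)(i := j)) (SIGMA i:UNIV. UNIV - {i})"
    by (auto simp: inj_on_def fun_eq_iff fun_upd_def split: if_splits)
  have "\<not> bij f" if "f \<in> F" for f
  proof
    assume "bij f"
    from that obtain p where "p \<in> (SIGMA i:UNIV. UNIV - {i})" "f = (\<lambda>(i, j). id(i := j)) p"
      unfolding F_def by blast
    then have "fst p \<noteq> snd p" "f (fst p) = f (snd p)" by (auto simp: split_def)
    with \<open>bij f\<close> show False by (metis bij_pointE)
  qed
  then have "\<bar>det R\<bar> \<le> 1 - (\<Sum>f\<in>F. \<Prod>k\<in>UNIV. R $ k $ f k)"
    by (rule abs_det_row_stochastic[OF R])
  also have "(\<Sum>f\<in>F. \<Prod>k\<in>UNIV. R $ k $ f k)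
      = (\<Sum>i\<in>UNIV. \<Sum>j\<in>UNIV - {i}. \<Prod>k\<in>UNIV. R $ k $ (id(i := j)) k)"
    unfolding F_def by (subst sum.reindex[OF inj]) (simp add: sum.Sigma split_def)
  also have "\<dots> = (\<Sum>i\<in>UNIV. (1 - R $ i $ i) * (\<Prod>k\<in>UNIV - {i}. R $ k $ k))"
  proof (rule sum.cong)
    fix i
    have "(\<Prod>k\<in>UNIV. R $ k $ (id(i := j)) k) = R $ i $ j * (\<Prod>k\<in>UNIV - {i}. R $ k $ k)" for j
      by (subst prod.remove[of _ i]) auto
    moreover have "(\<Sum>j\<in>UNIV - {i}. R $ i $ j) = 1 - R $ i $ i"
      using R by (simp add: sum_diff1 row_stochastic_def)
    ultimately show "(\<Sum>j\<in>UNIV - {i}. \<Prod>k\<in>UNIV. R $ k $ (id(i := j)) k)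
        = (1 - R $ i $ i) * (\<Prod>k\<in>UNIV - {i}. R $ k $ k)"
      by (simp flip: sum_distrib_right)
  qed simp
  \<comment> \<open>Each product runs over the rows other than \<open>i\<close>, so the Weierstrass
    inequality subtracts only their defects; subtracting the defect of row \<open>i\<close> too
    gives the common bound \<open>1 - S\<close>. The inequality runs against the chain and is handed
    over by \<open>ultimately\<close> as a separate fact.\<close>
  also have "\<dots> \<ge> (\<Sum>i\<in>UNIV. (1 - R $ i $ i) * (1 - S))"
  proof (rule sum_mono, rule mult_left_mono)
    fix i
    have "1 - S \<le> 1 - (\<Sum>k\<in>UNIV - {i}. 1 - R $ k $ k)"
      unfolding S_def using R1 by (intro diff_left_mono sum_mono2) auto
    also have "\<dots> \<le> (\<Prod>k\<in>UNIV - {i}. 1 - (1 - R $ k $ k))"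
      using R0 R1 by (intro Weierstrass_prod_ineq) auto
    finally show "1 - S \<le> (\<Prod>k\<in>UNIV - {i}. R $ k $ k)" by simp
  qed (use R1 in auto)
  ultimately show ?thesis by (simp add: S_def sum_distrib_right)
qed

text \<open>Every matrix on the segment from the identity to \<open>G\<close> has a positive
  quadratic form and is therefore invertible, so by continuity the determinant keeps the sign it has
  at the identity.\<close>

lemma det_pos_of_quadratic_form_pos:
  fixes G :: "real^'n^'n"
  assumes pos: "\<And>c. c \<noteq> 0 \<Longrightarrow> 0 < c \<bullet> (G *v c)"
  shows "0 < det G"
proof -
  define H where "H t = (1 - t) *\<^sub>R mat 1 + t *\<^sub>R G" for t :: real
  have nz: "det (H t) \<noteq> 0" if "0 \<le> t" "t \<le> 1" for t
  proof
    assume "det (H t) = 0"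
    then obtain c where c: "c \<noteq> 0" "H t *v c = 0"
      by (metis invertible_det_nz matrix_left_invertible_ker invertible_left_inverse)
    have "c \<bullet> (H t *v c) = (1 - t) * (c \<bullet> c) + t * (c \<bullet> (G *v c))"
      by (simp add: H_def matrix_vector_mult_add_rdistrib scaleR_matrix_vector_assoc[symmetric] inner_add_right)
    moreover have "0 < (1 - t) * (c \<bullet> c) + t * (c \<bullet> (G *v c))"
    proof (cases "t = 0")
      case False
      then have "0 < t * (c \<bullet> (G *v c))" using that pos[OF c(1)] by simp
      moreover have "0 \<le> (1 - t) * (c \<bullet> c)" using that by simp
      ultimately show ?thesis by simp
    qed (use c in simp)
    ultimately show False using c by simp
  qed
  have cont: "continuous_on {0..1} (\<lambda>t. det (H t))"
    unfolding det_def H_def by (auto intro!: continuous_intros)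
  show ?thesis
  proof (rule ccontr)
    assume "\<not> 0 < det G"
    then have "det (H 1) \<le> 0" "0 \<le> det (H 0)" by (simp_all add: H_def det_I)
    with IVT2'[of "\<lambda>t. det (H t)" 1 0 0] cont obtain t where "0 \<le> t" "t \<le> 1" "det (H t) = 0"
      by auto
    with nz show False by blast
  qed
qed

section \<open>Misreport matrices and the orderings\<close>

lemma sum_compose_eq_sum_card:
  fixes g :: "'d::finite \<Rightarrow> real"
  assumes "finite S"
  shows "(\<Sum>n\<in>S. g (h n)) = (\<Sum>i\<in>UNIV. real (card {n \<in> S. h n = i}) * g i)"
proof -
  have "(\<Sum>n\<in>S. g (h n)) = (\<Sum>i\<in>UNIV. \<Sum>n\<in>{n \<in> S. h n = i}. g (h n))"
    by (rule sum.group[symmetric]) (use assms in auto)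
  then show ?thesis by simp
qed

lemma label_freq_eq_row_sum:
  fixes x :: "'d::finite list"
  shows "label_freq x i = (\<Sum>j\<in>UNIV. misreport_matrix x xh $ i $ j)"
proof -
  have "(\<Sum>n\<in>{n. n < length x \<and> x ! n = i}. 1 :: real) =
      (\<Sum>j\<in>UNIV. real (card {n \<in> {n. n < length x \<and> x ! n = i}. xh ! n = j}) * 1)"
    by (rule sum_compose_eq_sum_card) simp
  then show ?thesis
    by (simp add: label_freq_def misreport_matrix_def sum_divide_distrib conj_assoc)
qed

lemma sum_label_freq:
  fixes x :: "'d::finite list"
  assumes "x \<noteq> []"
  shows "(\<Sum>i\<in>UNIV. label_freq x i) = 1"
proof -
  have "(\<Sum>n\<in>{n. n < length x}. 1 :: real) =
      (\<Sum>i\<in>UNIV. real (card {n \<in> {n. n < length x}. x ! n = i}) * 1)"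
    by (rule sum_compose_eq_sum_card) simp
  then have "real (length x) = (\<Sum>i\<in>UNIV. real (card {n. n < length x \<and> x ! n = i}))"
    by simp
  moreover have "(\<Sum>i\<in>UNIV. label_freq x i) =
      (\<Sum>i\<in>UNIV. real (card {n. n < length x \<and> x ! n = i})) / real (length x)"
    by (simp add: label_freq_def sum_divide_distrib)
  ultimately have "(\<Sum>i\<in>UNIV. label_freq x i) = real (length x) / real (length x)" by (simp only:)
  then show ?thesis using assms by simp
qed

text \<open>The left side depends on the misreport matrix alone, because label frequencies are its
  row sums. A bound on the mismatches of one dataset thus transfers to any other with the same
  matrix.\<close>

lemma sum_diagonal_defect:
  fixes x :: "'d::finite list"
  assumes "x \<noteq> []"
  shows "(\<Sum>i\<in>UNIV. label_freq x i - misreport_matrix x xh $ i $ i)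
    = real (card {n. n < length x \<and> xh ! n \<noteq> x ! n}) / real (length x)"
proof -
  let ?E = "{n. n < length x \<and> xh ! n = x ! n}"
  have "(\<Sum>n\<in>?E. 1 :: real) = (\<Sum>i\<in>UNIV. real (card {n \<in> ?E. x ! n = i}) * 1)"
    by (rule sum_compose_eq_sum_card) simp
  moreover have "{n \<in> ?E. x ! n = i} = {n. n < length x \<and> x ! n = i \<and> xh ! n = i}" for i by auto
  ultimately have *: "(\<Sum>i\<in>UNIV. misreport_matrix x xh $ i $ i) = real (card ?E) / real (length x)"
    by (simp add: misreport_matrix_def flip: sum_divide_distrib)
  have "{..<length x} = ?E \<union> {n. n < length x \<and> xh ! n \<noteq> x ! n}" by auto
  then have "card {..<length x} = card (?E \<union> {n. n < length x \<and> xh ! n \<noteq> x ! n})"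
    by (rule arg_cong)
  also have "\<dots> = card ?E + card {n. n < length x \<and> xh ! n \<noteq> x ! n}"
    by (rule card_Un_disjoint) auto
  finally have "card {..<length x} = card ?E + card {n. n < length x \<and> xh ! n \<noteq> x ! n}" .
  then have "real (length x) = real (card ?E) + real (card {n. n < length x \<and> xh ! n \<noteq> x ! n})"
    by simp
  then have "real (card ?E) / real (length x)
      + real (card {n. n < length x \<and> xh ! n \<noteq> x ! n}) / real (length x)
      = real (length x) / real (length x)"
    by (simp only: add_divide_distrib)
  also have "\<dots> = 1" using assms by simp
  finally have "real (card ?E) / real (length x)
      + real (card {n. n < length x \<and> xh ! n \<noteq> x ! n}) / real (length x) = 1" .
  with * assms show ?thesis by (simp add: sum_subtractf sum_label_freq)
qed

lemma label_freq_nonneg: "0 \<le> label_freq x i"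
  by (simp add: label_freq_def)

lemma label_freq_pos_iff: "0 < label_freq x i \<longleftrightarrow> i \<in> set x"
proof -
  let ?S = "{n. n < length x \<and> x ! n = i}"
  have "0 < card ?S \<longleftrightarrow> i \<in> set x" by (auto simp: in_set_conv_nth card_gt_0_iff)
  moreover have "i \<in> set x \<Longrightarrow> x \<noteq> []" by auto
  ultimately show ?thesis by (auto simp: label_freq_def zero_less_divide_iff)
qed

text \<open>Membership in a class of misreport matrices only yields some dataset with the same
  matrix; this brings its label frequencies back to the dataset at hand.\<close>

lemma label_freq_cong:
  fixes x x' :: "'d::finite list"
  assumes "misreport_matrix x xh = misreport_matrix x' xh'"
  shows "label_freq x = label_freq x'"
  using assms label_freq_eq_row_sum[of x _ xh] label_freq_eq_row_sum[of x' _ xh'] by auto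

lemma conditional_report_matrix_eq:
  assumes "x \<noteq> []"
  shows "conditional_report_matrix x xh $ i $ j = misreport_matrix x xh $ j $ i / label_freq x j"
  using assms by (simp add: conditional_report_matrix_def misreport_matrix_def label_freq_def)

lemma misreport_matrix_eq:
  "misreport_matrix x xh $ i $ j = label_freq x i * conditional_report_matrix x xh $ j $ i"
\<comment> \<open>If label \<open>i\<close> does not occur, both sides are 0.\<close>
proof (cases "card {n. n < length x \<and> x ! n = i} = 0")
  case True
  then have "{n. n < length x \<and> x ! n = i} = {}" by simp
  then have "{n. n < length x \<and> x ! n = i \<and> xh ! n = j} = {}" by auto
  then have "misreport_matrix x xh $ i $ j = 0"
    by (simp only: misreport_matrix_def vec_lambda_beta card.empty)
  moreover have "label_freq x i = 0" using True by (simp only: label_freq_def)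
  ultimately show ?thesis by simp
next
  case False
  then show ?thesis
    by (simp add: conditional_report_matrix_def misreport_matrix_def label_freq_def)
qed

lemma misreport_matrix_nonneg: "0 \<le> misreport_matrix x xh $ i $ j"
  by (simp add: misreport_matrix_def)

text \<open>Row \<open>i\<close> carries the factor \<open>label_freq x i\<close>. The product of
  these factors is the same for all reports of \<open>x\<close>, so comparing misreport determinants
  amounts to comparing conditional ones.\<close>

lemma det_misreport_matrix:
  fixes x :: "'d::finite list"
  shows "det (misreport_matrix x xh) = (\<Prod>i\<in>UNIV. label_freq x i) * det (conditional_report_matrix x xh)"
proof -
  have "misreport_matrix x xh =
      (\<chi> i. label_freq x i *s (\<chi> j. conditional_report_matrix x xh $ j $ i))"
    by (simp add: vec_eq_iff misreport_matrix_eq)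
  then have "det (misreport_matrix x xh) =
      (\<Prod>i\<in>UNIV. label_freq x i) * det (\<chi> i j. conditional_report_matrix x xh $ j $ i)"
    by (simp add: det_rows_mul)
  also have "(\<chi> i j. conditional_report_matrix x xh $ j $ i) = transpose (conditional_report_matrix x xh)"
    by (simp add: transpose_def)
  finally show ?thesis by simp
qed

lemma row_stochastic_transpose_conditional:
  fixes x :: "'d::finite list"
  assumes "\<And>i. 0 < label_freq x i"
  shows "row_stochastic (transpose (conditional_report_matrix x xh))"
  unfolding row_stochastic_def
proof (intro conjI allI)
  fix i
  have "label_freq x i * (\<Sum>j\<in>UNIV. conditional_report_matrix x xh $ j $ i) = label_freq x i"
    unfolding sum_distrib_left misreport_matrix_eq[symmetric] label_freq_eq_row_sum[symmetric] ..
  then show "(\<Sum>j\<in>UNIV. transpose (conditional_report_matrix x xh) $ i $ j) = 1"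
    using assms[of i] by (simp add: transpose_def)
qed (simp add: transpose_def conditional_report_matrix_def)

lemma column_stochastic_iff_row_stochastic:
  "column_stochastic T \<longleftrightarrow> row_stochastic (transpose T)"
  by (auto simp: column_stochastic_def row_stochastic_def transpose_def)

section \<open>The score as a product of determinants\<close>

text \<open>Group the indices that report \<open>a\<close> by their true label \<open>i\<close>: the
  kernel term depends on labels only, and the group sizes divided by the length are the entries of
  the misreport matrix.\<close>

lemma empirical_gram_eq:
  fixes x :: "'d::finite list"
  shows "empirical_gram K P x xh = transpose (misreport_matrix x xh)
    ** (\<chi> i j. kernel_integral K (P i) (P j)) ** misreport_matrix x xh"
proof -
  define k where "k i j = kernel_integral K (P i) (P j)" for i j
  define S where "S a = {n. n < length x \<and> xh ! n = a}" for a
  define c where "c i a = real (card {n \<in> S a. x ! n = i})" for i a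
  have [simp]: "finite (S a)" for a by (simp add: S_def)
  have Q: "misreport_matrix x xh $ i $ a = c i a / real (length x)" for i a
    unfolding misreport_matrix_def c_def S_def by (auto intro!: arg_cong[where f = card])
  have "(\<Sum>n\<in>S a. \<Sum>n'\<in>S b. k (x ! n) (x ! n')) = (\<Sum>i\<in>UNIV. \<Sum>j\<in>UNIV. c i a * c j b * k i j)" for a b
  proof -
    have "(\<Sum>n\<in>S a. \<Sum>n'\<in>S b. k (x ! n) (x ! n'))
        = (\<Sum>i\<in>UNIV. c i a * (\<Sum>n'\<in>S b. k i (x ! n')))"
      unfolding c_def by (rule sum_compose_eq_sum_card[where g = "\<lambda>i. \<Sum>n'\<in>S b. k i (x ! n')"]) simp
    also have "\<dots> = (\<Sum>i\<in>UNIV. c i a * (\<Sum>j\<in>UNIV. c j b * k i j))"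
      unfolding c_def by (intro sum.cong refl arg_cong2[where f = "(*)"] sum_compose_eq_sum_card) simp
    finally show ?thesis by (simp add: sum_distrib_left mult.assoc)
  qed
  then have "empirical_gram K P x xh =
      (\<chi> a b. (\<Sum>i\<in>UNIV. \<Sum>j\<in>UNIV. c i a * c j b * k i j) / (real (length x))\<^sup>2)"
    by (simp add: empirical_gram_def k_def S_def)
  also have "\<dots> = transpose (misreport_matrix x xh) ** ((\<chi> i j. k i j) ** misreport_matrix x xh)"
    by (simp add: vec_eq_iff matrix_matrix_mult_def transpose_def Q sum_divide_distrib
        sum_distrib_left power2_eq_square mult_ac)
  finally show ?thesis by (simp add: k_def matrix_mul_assoc)
qed

lemma gram_score_eq:
  "gram_score K P x xh = det (\<chi> i j. kernel_integral K (P i) (P j)) * (det (misreport_matrix x xh))\<^sup>2"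
  by (simp add: gram_score_def empirical_gram_eq det_mul power2_eq_square)

text \<open>The one property demanded of a kernel; it separates the treatment of the kernels from
  that of the orderings.\<close>

definition gram_positive :: "('y \<Rightarrow> 'y \<Rightarrow> real) \<Rightarrow> ('d::finite \<Rightarrow> 'y measure) \<Rightarrow> bool" where
  "gram_positive K P \<longleftrightarrow> (\<forall>c. (\<exists>a. c a \<noteq> 0) \<longrightarrow>
     0 < (\<Sum>a\<in>UNIV. \<Sum>b\<in>UNIV. c a * c b * kernel_integral K (P a) (P b)))"

lemma gram_score_less:
  assumes "gram_positive K P"
    and less: "\<bar>det (misreport_matrix x xh')\<bar> < \<bar>det (misreport_matrix x xh)\<bar>"
  shows "gram_score K P x xh' < gram_score K P x xh"
proof -
  define G where "G = (\<chi> i j. kernel_integral K (P i) (P j))"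
  have "0 < det G"
  proof (rule det_pos_of_quadratic_form_pos)
    fix c :: "real^'b" assume "c \<noteq> 0"
    then have "0 < (\<Sum>a\<in>UNIV. \<Sum>b\<in>UNIV. c $ a * c $ b * kernel_integral K (P a) (P b))"
      using assms(1) by (auto simp: gram_positive_def vec_eq_iff)
    then show "0 < c \<bullet> (G *v c)"
      by (simp add: G_def inner_vec_def matrix_vector_mult_def sum_distrib_left mult_ac)
  qed
  then show ?thesis
    using less by (simp add: gram_score_eq power2_strict_mono flip: G_def)
qed

section \<open>Comparing determinants along the three orderings\<close>

text \<open>The truthful conditional matrix is the identity, of determinant 1. A rival that reaches
  absolute value 1 has a permutation matrix, which the class forces to be the identity, and then no
  index is misreported.\<close>

lemma exact_match_det_less:
  fixes x :: "'d::finite list"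
  assumes rep: "is_report x xh'" and ord: "exact_match x xh xh'"
    and Q': "misreport_matrix x xh' \<in> Q_nonperm"
  shows "\<bar>det (misreport_matrix x xh')\<bar> < \<bar>det (misreport_matrix x xh)\<bar>"
proof -
  let ?C = "conditional_report_matrix x xh'"
  have x: "x \<noteq> []" using rep by (simp add: is_report_def)
  obtain y yh where y: "is_report y yh" "set y = UNIV" "misreport_matrix x xh' = misreport_matrix y yh"
    "\<not> (permutation_matrix (conditional_report_matrix y yh) \<and> conditional_report_matrix y yh \<noteq> mat 1)"
    using Q' by (auto simp: Q_nonperm_def)
  have freq: "label_freq x = label_freq y" using y(3) by (rule label_freq_cong)
  then have pos: "0 < label_freq x i" for i using y(2) by (simp add: label_freq_pos_iff)
  have "conditional_report_matrix y yh = ?C"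
    using x y(1,3) freq by (simp add: vec_eq_iff conditional_report_matrix_eq is_report_def)
  with y(4) have nonperm: "permutation_matrix ?C \<Longrightarrow> ?C = mat 1" by auto
  have row: "row_stochastic (transpose ?C)" using pos by (rule row_stochastic_transpose_conditional)
  have "\<bar>det ?C\<bar> \<noteq> 1"
  proof
    assume "\<bar>det ?C\<bar> = 1"
    then obtain g where g: "bij g" "\<And>i j. transpose ?C $ i $ j = (if j = g i then 1 else 0)"
      using row_stochastic_abs_det_eq_1[OF row] by auto
    then have "?C $ i $ j = (if i = g j then 1 else 0)" for i j by (simp add: transpose_def)
    with g(1) have "permutation_matrix ?C"
      unfolding permutation_matrix_def by (intro exI[of _ g]) (simp add: vec_eq_iff)
    then have C: "?C = mat 1" by (rule nonperm)
    have "xh' ! n = x ! n" if n: "n < length x" for n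
    proof (rule ccontr)
      assume "xh' ! n \<noteq> x ! n"
      then have "misreport_matrix x xh' $ (x ! n) $ (xh' ! n) = 0"
        by (simp add: misreport_matrix_eq C mat_def)
      then have "card {m. m < length x \<and> x ! m = x ! n \<and> xh' ! m = xh' ! n} = 0"
        using x by (simp add: misreport_matrix_def)
      then show False using n by auto
    qed
    then have "xh' = x" using rep by (intro nth_equalityI) (auto simp: is_report_def)
    then show False using ord by (simp add: exact_match_def)
  qed
  with abs_det_row_stochastic_le_1[OF row] have less: "\<bar>det ?C\<bar> < 1" by simp
  have "conditional_report_matrix x x $ i $ j = mat 1 $ i $ j" for i j
  proof (cases "i = j")
    case True
    moreover have "card {n. n < length x \<and> x ! n = j} \<noteq> 0"
      using pos[of j] by (simp only: label_freq_def) (metis div_0 less_irrefl of_nat_0)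
    ultimately show ?thesis
      by (simp add: conditional_report_matrix_def mat_def del: card_eq_0_iff)
  next
    case False
    then have "{n. n < length x \<and> x ! n = j \<and> x ! n = i} = {}" by auto
    then have "card {n. n < length x \<and> x ! n = j \<and> x ! n = i} = 0" by (simp only: card.empty)
    with False show ?thesis by (simp add: conditional_report_matrix_def mat_def)
  qed
  then have "conditional_report_matrix x x = mat 1" by (simp add: vec_eq_iff)
  then have "det (conditional_report_matrix x xh) = 1"
    using ord by (simp add: exact_match_def)
  moreover have "0 < (\<Prod>i\<in>UNIV. label_freq x i)" using pos by (intro prod_pos) auto
  ultimately show ?thesis using less by (simp add: det_misreport_matrix abs_mult)
qed

text \<open>Garbling multiplies the determinant by that of \<open>T\<close>. If this had absolute
  value 1, \<open>T\<close> would be a permutation matrix and its transpose would garble in the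
  opposite direction, which the asymmetric part of the relation excludes.\<close>

lemma strict_blackwell_det_less:
  fixes x :: "'d::finite list"
  assumes ord: "strict_blackwell_dominant x xh xh'"
  shows "\<bar>det (misreport_matrix x xh')\<bar> < \<bar>det (misreport_matrix x xh)\<bar>"
proof -
  let ?C = "conditional_report_matrix x"
  obtain T where T: "column_stochastic T" "T \<noteq> mat 1" "T ** ?C xh = ?C xh'"
    and reg: "misreport_matrix x xh \<in> Q_reg" "misreport_matrix x xh' \<in> Q_reg"
    and strict: "\<not> blackwell_dominant x xh' xh"
    using ord by (auto simp: strict_blackwell_dominant_def blackwell_dominant_def)
  have row: "row_stochastic (transpose T)"
    using T(1) by (simp add: column_stochastic_iff_row_stochastic)
  have "\<bar>det T\<bar> \<noteq> 1"
  proof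
    assume "\<bar>det T\<bar> = 1"
    then obtain g where g: "bij g" "\<And>i j. transpose T $ i $ j = (if j = g i then 1 else 0)"
      using row_stochastic_abs_det_eq_1[OF row] by auto
    have T_eq: "T $ i $ j = (if i = g j then 1 else 0)" for i j
      using g(2)[of j i] by (simp add: transpose_def)
    have "T $ k $ i * T $ k $ j = (if k = g i then (if i = j then 1 else 0) else 0)" for i j k
      using g(1) by (auto simp: T_eq bij_def inj_def)
    then have "transpose T ** T = mat 1"
      by (simp add: vec_eq_iff matrix_matrix_mult_def transpose_def mat_def)
    then have "transpose T ** ?C xh' = ?C xh"
      by (simp add: T(3)[symmetric] matrix_mul_assoc)
    moreover have "column_stochastic (transpose T)"
    proof -
      have "T $ i $ j = (if j = inv g i then 1 else 0)" for i j
        using g(1) by (auto simp: T_eq bij_inv_eq_iff)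
      then show ?thesis by (simp add: column_stochastic_def transpose_def)
    qed
    moreover have "transpose T \<noteq> mat 1" using T(2) by (metis transpose_mat transpose_transpose)
    ultimately have "blackwell_dominant x xh' xh"
      using reg by (auto simp: blackwell_dominant_def)
    then show False using strict by simp
  qed
  with abs_det_row_stochastic_le_1[OF row] have less: "\<bar>det T\<bar> < 1" by simp
  have "det (misreport_matrix x xh) \<noteq> 0"
    using reg(1) by (simp add: Q_reg_def invertible_det_nz)
  moreover have "\<bar>det (misreport_matrix x xh')\<bar> = \<bar>det T\<bar> * \<bar>det (misreport_matrix x xh)\<bar>"
    by (simp add: det_misreport_matrix T(3)[symmetric] det_mul abs_mult)
  ultimately show ?thesis using less by simp
qed

text \<open>Each mismatch costs between \<open>lo\<close> and \<open>hi\<close>, so distance sums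
  are mismatch counts up to these factors, and \<open>distance_ratio D\<close> in the ordering
  cancels exactly the quotient \<open>hi / lo\<close>.\<close>

lemma dist_order_mismatch_less:
  fixes x :: "'d::finite list"
  assumes D: "distance_function D" and L: "0 < L"
    and ord: "dist_order (1 / (4 * L * distance_ratio D)) D x xh xh'"
  shows "4 * L * real (card {n. n < length x \<and> xh ! n \<noteq> x ! n})
    < real (card {n. n < length x \<and> xh' ! n \<noteq> x ! n})"
proof -
  have D0: "D a a = 0" for a using D by (simp add: distance_function_def)
  have Dpos: "a \<noteq> b \<Longrightarrow> 0 < D a b" for a b using D by (simp add: distance_function_def)
  let ?m = "\<lambda>xh. real (card {n. n < length x \<and> xh ! n \<noteq> x ! n})"
  have sum_eq: "(\<Sum>n<length x. D (yh ! n) (x ! n)) =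
      (\<Sum>n\<in>{n. n < length x \<and> yh ! n \<noteq> x ! n}. D (yh ! n) (x ! n))" for yh
    by (rule sum.mono_neutral_right) (auto simp: D0)
  show ?thesis
  proof (cases "\<exists>a b :: 'd. a \<noteq> b")
    \<comment> \<open>With a single label both distance sums are empty, so the ordering hypothesis
      is contradictory.\<close>
    case False
    then have "{n. n < length x \<and> yh ! n \<noteq> x ! n} = {}" for yh by blast
    then show ?thesis using ord unfolding dist_order_def sum_eq by (simp only: sum.empty)
  next
    case True
    define hi where "hi = Max {D a b | a b. True}"
    define lo where "lo = Min {D a b | a b. a \<noteq> b}"
    have fin: "finite {D a b | a b. True}" "finite {D a b | a b. a \<noteq> b}"
      by (rule finite_subset[of _ "range (case_prod D)"]; force)+
    have hi: "D a b \<le> hi" for a b unfolding hi_def using fin by (intro Max_ge) auto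
    have lo: "lo \<le> D a b" if "a \<noteq> b" for a b unfolding lo_def using fin that by (intro Min_le) auto
    have "lo \<in> {D a b | a b. a \<noteq> b}" unfolding lo_def using fin True by (intro Min_in) auto
    then have lo0: "0 < lo" using Dpos by auto
    with lo hi True have hi0: "0 < hi" by (metis order_less_le_trans)
    have "lo * ?m xh = (\<Sum>n\<in>{n. n < length x \<and> xh ! n \<noteq> x ! n}. lo)" by simp
    also have "\<dots> \<le> (\<Sum>n<length x. D (xh ! n) (x ! n))"
      unfolding sum_eq by (intro sum_mono lo) auto
    also have "\<dots> < 1 / (4 * L * (hi / lo)) * (\<Sum>n<length x. D (xh' ! n) (x ! n))"
      using ord by (simp add: dist_order_def distance_ratio_def hi_def lo_def)
    also have "\<dots> \<le> 1 / (4 * L * (hi / lo)) * (\<Sum>n\<in>{n. n < length x \<and> xh' ! n \<noteq> x ! n}. hi)"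
      unfolding sum_eq using hi0 lo0 L by (intro mult_left_mono sum_mono hi) auto
    also have "\<dots> = lo * (?m xh' / (4 * L))"
      using hi0 lo0 L by (simp add: field_simps)
    finally have "lo * ?m xh < lo * (?m xh' / (4 * L))" .
    then show ?thesis using lo0 L by (simp add: field_simps)
  qed
qed

text \<open>Here \<open>f\<close> is the off-diagonal mass of the misreport matrix, and
  \<open>S\<close> is the same mass after dividing each row by its label frequency. All frequencies
  lie between \<open>?q a\<close> and \<open>L * ?q a\<close>, so the factor \<open>4 * L\<close>
  between the values of \<open>f\<close> leaves a factor 4 between those of
  \<open>S\<close>.\<close>

lemma dist_order_det_less:
  fixes x :: "'d::finite list"
  assumes L: "1 \<le> L" and D: "distance_function D"
    and x: "x \<noteq> []"
    and Q': "misreport_matrix x xh' \<in> Q_diag_dom L (1 / (64 * L\<^sup>2 * (real CARD('d))\<^sup>2))"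
    and ord: "dist_order (1 / (4 * L * distance_ratio D)) D x xh xh'"
  shows "\<bar>det (misreport_matrix x xh')\<bar> < \<bar>det (misreport_matrix x xh)\<bar>"
proof -
  let ?q = "label_freq x" and ?d = "real CARD('d)" and ?C = "conditional_report_matrix x"
  define f where "f yh = (\<Sum>i\<in>UNIV. ?q i - misreport_matrix x yh $ i $ i)" for yh
  define S where "S yh = (\<Sum>i\<in>UNIV. 1 - transpose (?C yh) $ i $ i)" for yh
  have d: "1 \<le> ?d" using zero_less_card_finite[where 'a = 'd] by linarith
  obtain y yh where y: "is_report y yh" "misreport_matrix x xh' = misreport_matrix y yh"
    "\<And>a b. label_freq y a \<le> L * label_freq y b"
    "real (card {n. n < length y \<and> yh ! n \<noteq> y ! n}) \<le> real (length y) * (1 / (64 * L\<^sup>2 * ?d\<^sup>2))"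
    using Q' unfolding Q_diag_dom_def by blast
  have freq: "label_freq x = label_freq y" using y(2) by (rule label_freq_cong)
  have ratio: "?q a \<le> L * ?q b" for a b using y(3) freq by simp
  have f_eq: "f yh = real (card {n. n < length x \<and> yh ! n \<noteq> x ! n}) / real (length x)" for yh
    unfolding f_def using x by (rule sum_diagonal_defect)
  have f'_le: "f xh' \<le> 1 / (64 * L\<^sup>2 * ?d\<^sup>2)"
  proof -
    have "f xh' = real (card {n. n < length y \<and> yh ! n \<noteq> y ! n}) / real (length y)"
      unfolding f_def freq y(2) using y(1) by (intro sum_diagonal_defect) (simp add: is_report_def)
    also have "\<dots> \<le> 1 / (64 * L\<^sup>2 * ?d\<^sup>2)"
      using y(1,4) by (simp add: is_report_def divide_le_eq mult.commute)
    finally show ?thesis .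
  qed
  have f_less: "4 * L * f xh < f xh'"
    using dist_order_mismatch_less[OF D _ ord] L x by (simp add: f_eq divide_strict_right_mono)
  \<comment> \<open>A least frequent label: since the frequencies sum to 1 and are at most
    \<open>L * ?q a\<close>, its own is at least \<open>1 / (?d * L)\<close>.\<close>
  obtain a where a: "\<And>i. ?q a \<le> ?q i"
    using ex_min_if_finite[of "range ?q"] by (auto simp: not_less)
  have "1 = (\<Sum>i\<in>UNIV. ?q i)" using x by (simp add: sum_label_freq)
  also have "\<dots> \<le> (\<Sum>i\<in>(UNIV::'d set). L * ?q a)" by (intro sum_mono ratio)
  finally have qa: "1 \<le> ?d * L * ?q a" by simp
  have qa0: "0 < ?q a"
    using qa label_freq_nonneg[of x a] by (cases "?q a = 0") auto
  with a have pos: "0 < ?q i" for i by (meson less_le_trans)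
  have row: "row_stochastic (transpose (?C yh))" for yh
    using pos by (rule row_stochastic_transpose_conditional)
  have ratio_term: "1 - transpose (?C yh) $ i $ i = (?q i - misreport_matrix x yh $ i $ i) / ?q i" for yh i
    using pos[of i] x by (simp add: transpose_def conditional_report_matrix_eq field_simps)
  have num: "0 \<le> ?q i - misreport_matrix x yh $ i $ i" for yh i
  proof -
    have "misreport_matrix x yh $ i $ i \<le> (\<Sum>j\<in>UNIV. misreport_matrix x yh $ i $ j)"
      by (intro member_le_sum) (auto simp: misreport_matrix_nonneg)
    then show ?thesis by (simp flip: label_freq_eq_row_sum)
  qed
  have S_le: "S yh \<le> f yh / ?q a" for yh
    unfolding S_def f_def ratio_term sum_divide_distrib
    using num a qa0 by (intro sum_mono divide_left_mono) (auto intro: mult_pos_pos pos)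
  have S_ge: "f yh / (L * ?q a) \<le> S yh" for yh
    unfolding S_def f_def ratio_term sum_divide_distrib
    using num ratio L qa0 by (intro sum_mono divide_left_mono) (auto intro!: mult_pos_pos pos)
  have "4 * S xh \<le> 4 * (f xh / ?q a)" using S_le[of xh] by simp
  also have "\<dots> = (4 * L * f xh) / (L * ?q a)" using L by simp
  also have "\<dots> < f xh' / (L * ?q a)"
    using f_less L qa0 by (intro divide_strict_right_mono) auto
  also have "\<dots> \<le> S xh'" by (rule S_ge)
  finally have less: "4 * S xh < S xh'" .
  have S0: "0 \<le> S yh" for yh
    unfolding S_def ratio_term using num pos by (intro sum_nonneg divide_nonneg_pos) auto
  \<comment> \<open>The class bound is of order \<open>1 / t\<^sup>2\<close> for
    \<open>t = ?d * L\<close>, while \<open>?q a\<close> is at least \<open>1 / t\<close>; this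
    makes the defect small relative to the rarest label.\<close>
  have "f xh' \<le> ?q a / 2"
  proof -
    define t where "t = ?d * L"
    have t: "1 \<le> t" unfolding t_def using mult_mono[of 1 ?d 1 L] d L by simp
    have "f xh' \<le> 1 / (64 * (t * t))" using f'_le by (simp add: t_def power2_eq_square mult_ac)
    also have "\<dots> \<le> 1 / (2 * t)"
      using t by (intro divide_left_mono mult_mono) (auto intro: mult_pos_pos)
    also have "\<dots> \<le> (t * ?q a) / (2 * t)"
      using qa t by (intro divide_right_mono) (auto simp: t_def)
    also have "\<dots> = ?q a / 2" using t by simp
    finally show ?thesis .
  qed
  then have "f xh' / ?q a \<le> 1 / 2" using qa0 by (simp add: divide_le_eq)
  with S_le[of xh'] have half: "S xh' \<le> 1 / 2" by (rule order_trans)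
  have "\<bar>det (?C xh')\<bar> \<le> 1 - S xh' * (1 - S xh')"
    using abs_det_row_stochastic_le[OF row[of xh']] by (simp only: S_def det_transpose)
  also have "\<dots> \<le> 1 - S xh' * (1 / 2)"
    using half S0[of xh'] by (intro diff_left_mono mult_left_mono) auto
  \<comment> \<open>The two determinant estimates are separated precisely by
    \<open>4 * S xh < S xh'\<close>.\<close>
  also have "\<dots> < 1 - 2 * S xh" using less by simp
  also have "\<dots> \<le> det (?C xh)"
    using det_row_stochastic_ge[OF row[of xh]] by (simp only: S_def det_transpose)
  finally have "\<bar>det (?C xh')\<bar> < \<bar>det (?C xh)\<bar>" by simp
  moreover have "0 < (\<Prod>i\<in>UNIV. ?q i)" using pos by (intro prod_pos) auto
  ultimately show ?thesis by (simp add: det_misreport_matrix abs_mult)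
qed

lemma gram_positive_preserves:
  fixes \<P> :: "('d::finite \<Rightarrow> 'y measure) set"
  assumes "\<And>P. P \<in> \<P> \<Longrightarrow> gram_positive K P" and "1 \<le> L"
  shows "score_preserves K \<P> Q_nonperm exact_match"
    and "score_preserves K \<P> Q_reg strict_blackwell_dominant"
    and "distance_function D \<Longrightarrow>
      score_preserves K \<P> (Q_diag_dom L (1 / (64 * L\<^sup>2 * (real CARD('d))\<^sup>2)))
        (dist_order (1 / (4 * L * distance_ratio D)) D)"
proof -
  show "score_preserves K \<P> Q_nonperm exact_match"
    unfolding score_preserves_def
    by (intro ballI allI impI gram_score_less assms(1) exact_match_det_less) auto
  show "score_preserves K \<P> Q_reg strict_blackwell_dominant"
    unfolding score_preserves_def
    by (intro ballI allI impI gram_score_less assms(1) strict_blackwell_det_less) auto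
  show "score_preserves K \<P> (Q_diag_dom L (1 / (64 * L\<^sup>2 * (real CARD('d))\<^sup>2)))
      (dist_order (1 / (4 * L * distance_ratio D)) D)" if "distance_function D"
    unfolding score_preserves_def
    by (intro ballI allI impI gram_score_less assms(1) dist_order_det_less[OF assms(2) that])
      (auto simp: is_report_def)
qed

section \<open>Strictly positive definite kernels\<close>

text \<open>The linear combination of the \<open>P a\<close> with weights \<open>w\<close>, realised
  as a bind over a weighted label set. Total weight at most 1 keeps it a subprobability, from which
  finiteness follows.\<close>

definition mixture :: "('d::finite \<Rightarrow> real) \<Rightarrow> ('d \<Rightarrow> 'y measure) \<Rightarrow> 'y measure" where
  "mixture w P = point_measure UNIV (\<lambda>a. ennreal (w a)) \<bind> P"

lemma
  fixes P :: "'d::finite \<Rightarrow> 'y measure"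
  assumes P: "is_experiment M P" and w: "\<And>a. 0 \<le> w a" "(\<Sum>a\<in>UNIV. w a) \<le> 1"
  shows sets_mixture: "sets (mixture w P) = sets M"
    and finite_measure_mixture: "finite_measure (mixture w P)"
    and nn_integral_mixture: "f \<in> borel_measurable M \<Longrightarrow>
      (\<integral>\<^sup>+y. f y \<partial>mixture w P) = (\<Sum>a\<in>UNIV. ennreal (w a) * (\<integral>\<^sup>+y. f y \<partial>P a))"
    and measure_mixture: "A \<in> sets M \<Longrightarrow>
      measure (mixture w P) A = (\<Sum>a\<in>UNIV. w a * measure (P a) A)"
proof -
  let ?D = "point_measure UNIV (\<lambda>a. ennreal (w a))"
  have meas: "P \<in> ?D \<rightarrow>\<^sub>M subprob_algebra M"
    using P by (auto simp: is_experiment_def space_subprob_algebra prob_space_imp_subprob_space)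
  have sub: "subprob_space ?D"
  proof (rule subprob_spaceI)
    show "emeasure ?D (space ?D) \<le> 1"
      using w by (simp add: space_point_measure emeasure_point_measure_finite2 sum_ennreal)
  qed (simp add: space_point_measure)
  show sets: "sets (mixture w P) = sets M"
    unfolding mixture_def using P by (intro sets_bind) (auto simp: is_experiment_def space_point_measure)
  have "subprob_space (mixture w P)"
    unfolding mixture_def using sub meas by (rule subprob_space_bind)
  then interpret mix: subprob_space "mixture w P" .
  show "finite_measure (mixture w P)" by unfold_locales
  show nn: "(\<integral>\<^sup>+y. f y \<partial>mixture w P) = (\<Sum>a\<in>UNIV. ennreal (w a) * (\<integral>\<^sup>+y. f y \<partial>P a))"
    if "f \<in> borel_measurable M" for f
    unfolding mixture_def
    by (simp add: nn_integral_bind[OF that meas] nn_integral_point_measure_finite)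
  show "measure (mixture w P) A = (\<Sum>a\<in>UNIV. w a * measure (P a) A)" if A: "A \<in> sets M"
  proof -
    have fin: "finite_measure (P a)" "A \<in> sets (P a)" for a
      using P A by (auto simp: is_experiment_def prob_space.finite_measure)
    have "emeasure (mixture w P) A = (\<Sum>a\<in>UNIV. ennreal (w a) * emeasure (P a) A)"
      using nn[of "indicator A"] A fin(2) by (simp add: sets)
    also have "\<dots> = (\<Sum>a\<in>UNIV. ennreal (w a * measure (P a) A))"
      using w fin by (simp add: finite_measure.emeasure_eq_measure ennreal_mult)
    also have "\<dots> = ennreal (\<Sum>a\<in>UNIV. w a * measure (P a) A)"
      using w by (intro sum_ennreal) auto
    finally show ?thesis using w by (simp add: measure_def sum_nonneg)
  qed
qed

text \<open>Tonelli and the formula for a single mixture, applied in each variable; nonnegative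
  integrands keep integrability out of the computation.\<close>

lemma nn_integral_pair_mixture:
  fixes P :: "'d::finite \<Rightarrow> 'y measure"
  assumes P: "is_experiment M P"
    and w: "\<And>a. 0 \<le> w a" "(\<Sum>a\<in>UNIV. w a) \<le> 1"
    and v: "\<And>a. 0 \<le> v a" "(\<Sum>a\<in>UNIV. v a) \<le> 1"
    and f: "f \<in> borel_measurable (M \<Otimes>\<^sub>M M)"
  shows "(\<integral>\<^sup>+z. f z \<partial>(mixture w P \<Otimes>\<^sub>M mixture v P))
    = (\<Sum>a\<in>UNIV. \<Sum>b\<in>UNIV. ennreal (w a * v b) * (\<integral>\<^sup>+z. f z \<partial>(P a \<Otimes>\<^sub>M P b)))"
proof -
  interpret v: finite_measure "mixture v P" using P v by (rule finite_measure_mixture)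
  have sets_P: "sets (P a) = sets M" and "finite_measure (P a)" for a
    using P by (auto simp: is_experiment_def prob_space.finite_measure)
  then interpret P: finite_measure "P a" for a by blast
  note sets_w = sets_mixture[OF P w] and sets_v = sets_mixture[OF P v]
  have f': "f \<in> borel_measurable (M \<Otimes>\<^sub>M P b)" "f \<in> borel_measurable (P a \<Otimes>\<^sub>M P b)"
    "f \<in> borel_measurable (mixture w P \<Otimes>\<^sub>M mixture v P)" for a b
    using f by (simp_all add: sets_P sets_w sets_v cong: measurable_cong_sets sets_pair_measure_cong)
  have f_sec: "(\<lambda>y. f (x, y)) \<in> borel_measurable M" if "x \<in> space M" for x
    using f that by (rule measurable_compose_Pair1[rotated])
  have sp: "space (mixture w P) = space M" using sets_w by (rule sets_eq_imp_space_eq)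
  have "(\<integral>\<^sup>+z. f z \<partial>(mixture w P \<Otimes>\<^sub>M mixture v P)) = (\<integral>\<^sup>+x. \<integral>\<^sup>+y. f (x, y) \<partial>mixture v P \<partial>mixture w P)"
    using f'(3) by (rule v.nn_integral_fst[symmetric])
  also have "\<dots> = (\<integral>\<^sup>+x. (\<Sum>b\<in>UNIV. ennreal (v b) * (\<integral>\<^sup>+y. f (x, y) \<partial>P b)) \<partial>mixture w P)"
    by (intro nn_integral_cong nn_integral_mixture[OF P v] f_sec) (simp add: sp)
  also have "\<dots> = (\<Sum>a\<in>UNIV. ennreal (w a) * (\<integral>\<^sup>+x. (\<Sum>b\<in>UNIV. ennreal (v b) * (\<integral>\<^sup>+y. f (x, y) \<partial>P b)) \<partial>P a))"
    using f'(1) by (intro nn_integral_mixture[OF P w] borel_measurable_sum borel_measurable_times_ennreal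
        P.borel_measurable_nn_integral_fst) auto
  also have "\<dots> = (\<Sum>a\<in>UNIV. ennreal (w a) * (\<Sum>b\<in>UNIV. ennreal (v b) * (\<integral>\<^sup>+z. f z \<partial>(P a \<Otimes>\<^sub>M P b))))"
  proof -
    have m: "(\<lambda>x. \<integral>\<^sup>+y. f (x, y) \<partial>P b) \<in> borel_measurable (P a)" for a b
      using f'(2) by (rule P.borel_measurable_nn_integral_fst)
    have "(\<integral>\<^sup>+x. (\<Sum>b\<in>UNIV. ennreal (v b) * (\<integral>\<^sup>+y. f (x, y) \<partial>P b)) \<partial>P a)
        = (\<Sum>b\<in>UNIV. ennreal (v b) * (\<integral>\<^sup>+z. f z \<partial>(P a \<Otimes>\<^sub>M P b)))" for a
      using m by (simp add: nn_integral_sum nn_integral_cmult P.nn_integral_fst f'(2))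
    then show ?thesis by simp
  qed
  finally show ?thesis using w v by (simp add: sum_distrib_left ennreal_mult mult.assoc)
qed

text \<open>The positive and negative parts of the kernel are each covered by the nonnegative case;
  integrability makes all of these integrals finite, so they can be subtracted.\<close>

lemma kernel_integral_mixture:
  fixes P :: "'d::finite \<Rightarrow> 'y measure"
  assumes P: "is_experiment M P"
    and w: "\<And>a. 0 \<le> w a" "(\<Sum>a\<in>UNIV. w a) \<le> 1"
    and v: "\<And>a. 0 \<le> v a" "(\<Sum>a\<in>UNIV. v a) \<le> 1"
    and K: "(\<lambda>z. K (fst z) (snd z)) \<in> borel_measurable (M \<Otimes>\<^sub>M M)"
    and int: "\<And>a b. kernel_integrable K (P a) (P b)"
    and int_mix: "kernel_integrable K (mixture w P) (mixture v P)"
  shows "kernel_integral K (mixture w P) (mixture v P)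
    = (\<Sum>a\<in>UNIV. \<Sum>b\<in>UNIV. w a * v b * kernel_integral K (P a) (P b))"
proof -
  define k where "k z = K (fst z) (snd z)" for z
  have [measurable]: "k \<in> borel_measurable (M \<Otimes>\<^sub>M M)" using K by (simp add: k_def[abs_def])
  define pos where "pos a b = enn2real (\<integral>\<^sup>+z. ennreal (k z) \<partial>(P a \<Otimes>\<^sub>M P b))" for a b
  define neg where "neg a b = enn2real (\<integral>\<^sup>+z. ennreal (- k z) \<partial>(P a \<Otimes>\<^sub>M P b))" for a b
  have int': "integrable (P a \<Otimes>\<^sub>M P b) k" for a b
    using int by (simp add: kernel_integrable_def k_def[abs_def])
  have pos: "(\<integral>\<^sup>+z. ennreal (k z) \<partial>(P a \<Otimes>\<^sub>M P b)) = ennreal (pos a b)"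
    and neg: "(\<integral>\<^sup>+z. ennreal (- k z) \<partial>(P a \<Otimes>\<^sub>M P b)) = ennreal (neg a b)" for a b
    using int'[of a b] unfolding pos_def neg_def by (auto simp: real_integrable_def less_top)
  have kPP: "kernel_integral K (P a) (P b) = pos a b - neg a b" for a b
    using real_lebesgue_integral_def[OF int'[of a b]]
    by (simp add: kernel_integral_def pos_def neg_def k_def[abs_def])
  have [simp]: "0 \<le> pos a b" "0 \<le> neg a b" for a b by (simp_all add: pos_def neg_def)
  have mix: "(\<integral>\<^sup>+z. ennreal (g z) \<partial>(mixture w P \<Otimes>\<^sub>M mixture v P))
      = ennreal (\<Sum>a\<in>UNIV. \<Sum>b\<in>UNIV. w a * v b * r a b)"
    if "\<And>a b. (\<integral>\<^sup>+z. ennreal (g z) \<partial>(P a \<Otimes>\<^sub>M P b)) = ennreal (r a b)"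
      and [measurable]: "g \<in> borel_measurable (M \<Otimes>\<^sub>M M)" and "\<And>a b. 0 \<le> r a b" for g r
    using that(1,3) w v
    by (simp add: nn_integral_pair_mixture[OF P w v] sum_ennreal sum_nonneg flip: ennreal_mult)
  have "kernel_integral K (mixture w P) (mixture v P)
      = enn2real (\<integral>\<^sup>+z. ennreal (k z) \<partial>(mixture w P \<Otimes>\<^sub>M mixture v P))
        - enn2real (\<integral>\<^sup>+z. ennreal (- k z) \<partial>(mixture w P \<Otimes>\<^sub>M mixture v P))"
    using int_mix unfolding kernel_integral_def k_def kernel_integrable_def
    by (rule real_lebesgue_integral_def)
  also have "\<dots> = (\<Sum>a\<in>UNIV. \<Sum>b\<in>UNIV. w a * v b * pos a b) - (\<Sum>a\<in>UNIV. \<Sum>b\<in>UNIV. w a * v b * neg a b)"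
    using w v by (simp add: mix[OF pos] mix[OF neg] sum_nonneg)
  finally show ?thesis
    by (simp add: kPP right_diff_distrib sum_subtractf)
qed

text \<open>The positive and the negative part of \<open>c\<close> give two mixtures. If they
  coincided, the experiment would be linearly dependent; otherwise strict definiteness applies to
  their difference, whose energy is the quadratic form up to scaling.\<close>

lemma integrally_strictly_pd_gram_positive:
  fixes P :: "'d::finite \<Rightarrow> 'y measure"
  assumes K: "integrally_strictly_pd M K" and P: "P \<in> P_indep M"
  shows "gram_positive K P"
  unfolding gram_positive_def
proof (intro allI impI)
  fix c :: "'d \<Rightarrow> real" assume c: "\<exists>a. c a \<noteq> 0"
  have exp: "is_experiment M P" using P by (simp add: P_indep_def)
  have indep: "(\<And>A. A \<in> sets M \<Longrightarrow> (\<Sum>a\<in>UNIV. u a * measure (P a) A) = 0) \<Longrightarrow> u a = 0" for u a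
    using P by (simp add: P_indep_def)
  have fin_P: "finite_measure (P a)" "sets (P a) = sets M" for a
    using exp by (auto simp: is_experiment_def prob_space.finite_measure)
  have meas: "(\<lambda>z. K (fst z) (snd z)) \<in> borel_measurable (M \<Otimes>\<^sub>M M)"
    using K by (simp add: integrally_strictly_pd_def pd_kernel_def)
  have strict: "kernel_integrable K \<mu> \<mu>" "kernel_integrable K \<mu> \<nu>" "kernel_integrable K \<nu> \<mu>"
    "kernel_integrable K \<nu> \<nu>"
    "0 < kernel_integral K \<mu> \<mu> - kernel_integral K \<mu> \<nu> - kernel_integral K \<nu> \<mu> + kernel_integral K \<nu> \<nu>"
    if "finite_measure \<mu>" "finite_measure \<nu>" "sets \<mu> = sets M" "sets \<nu> = sets M" "\<mu> \<noteq> \<nu>" for \<mu> \<nu>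
    using K that unfolding integrally_strictly_pd_def by blast+
  \<comment> \<open>The definition grants integrability only for pairs of distinct measures; the
    case of equal ones comes from pairing \<open>P a\<close> with the null measure.\<close>
  have int: "kernel_integrable K (P a) (P b)" for a b
  proof (cases "P a = P b")
    case True
    have "emeasure (P a) (space (P a)) = 1"
      using exp by (simp add: is_experiment_def prob_space.emeasure_space_1)
    then have "P a \<noteq> null_measure M" by auto
    then have "kernel_integrable K (P a) (P a)"
      by (intro strict(1)[of _ "null_measure M"] fin_P) (auto intro: finite_measureI)
    with True show ?thesis by simp
  qed (intro strict(2) fin_P)
  \<comment> \<open>Dividing by the total absolute weight makes both mixtures subprobabilities; the
    positive factor \<open>s * s\<close> is removed at the end.\<close>
  define s where "s = (\<Sum>a\<in>UNIV. \<bar>c a\<bar>)"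
  have s: "0 < s" unfolding s_def using c by (auto intro!: sum_pos2)
  define w where "w a = max 0 (c a) / s" for a
  define v where "v a = max 0 (- c a) / s" for a
  have w: "0 \<le> w a" and v: "0 \<le> v a" for a using s by (simp_all add: w_def v_def)
  have w1: "(\<Sum>a\<in>UNIV. w a) \<le> 1" and v1: "(\<Sum>a\<in>UNIV. v a) \<le> 1"
    using s by (auto simp: w_def v_def s_def divide_le_eq intro!: sum_mono simp flip: sum_divide_distrib)
  have wv: "w a - v a = c a / s" for a
    by (simp add: w_def v_def max_def flip: diff_divide_distrib)
  note mw = exp w w1 and mv = exp v v1
  have neq: "mixture w P \<noteq> mixture v P"
  proof
    assume "mixture w P = mixture v P"
    then have "(\<Sum>a\<in>UNIV. w a * measure (P a) A) = (\<Sum>a\<in>UNIV. v a * measure (P a) A)"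
      if "A \<in> sets M" for A
      using measure_mixture[OF mw that] measure_mixture[OF mv that] by simp
    then have "(\<Sum>a\<in>UNIV. (w a - v a) * measure (P a) A) = 0" if "A \<in> sets M" for A
      using that by (simp add: left_diff_distrib sum_subtractf)
    then have "w a - v a = 0" for a using indep[of "\<lambda>a. w a - v a"] by simp
    then show False using c s by (simp add: wv)
  qed
  note strict_mix = strict[OF finite_measure_mixture[OF mw] finite_measure_mixture[OF mv]
      sets_mixture[OF mw] sets_mixture[OF mv] neq]
  let ?k = "\<lambda>a b. kernel_integral K (P a) (P b)"
  have "0 < (\<Sum>a\<in>UNIV. \<Sum>b\<in>UNIV. w a * w b * ?k a b) - (\<Sum>a\<in>UNIV. \<Sum>b\<in>UNIV. w a * v b * ?k a b)
      - (\<Sum>a\<in>UNIV. \<Sum>b\<in>UNIV. v a * w b * ?k a b) + (\<Sum>a\<in>UNIV. \<Sum>b\<in>UNIV. v a * v b * ?k a b)"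
    using strict_mix(5)
    unfolding kernel_integral_mixture[OF exp w w1 w w1 meas int strict_mix(1)]
      kernel_integral_mixture[OF exp w w1 v v1 meas int strict_mix(2)]
      kernel_integral_mixture[OF exp v v1 w w1 meas int strict_mix(3)]
      kernel_integral_mixture[OF exp v v1 v v1 meas int strict_mix(4)] .
  also have "\<dots> = (\<Sum>a\<in>UNIV. \<Sum>b\<in>UNIV. (w a - v a) * (w b - v b) * ?k a b)"
    by (simp add: algebra_simps sum.distrib sum_subtractf)
  also have "\<dots> = (\<Sum>a\<in>UNIV. \<Sum>b\<in>UNIV. c a * c b * ?k a b) / (s * s)"
    by (simp add: wv sum_divide_distrib)
  finally show "0 < (\<Sum>a\<in>UNIV. \<Sum>b\<in>UNIV. c a * c b * ?k a b)"
    using s by (simp add: zero_less_divide_iff)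
qed

section \<open>Kernels given by finite-dimensional feature maps\<close>

text \<open>By Fubini the double integral of such a kernel is the inner product of the mean feature
  vectors, so energies become squared norms.\<close>

lemma
  fixes \<phi> :: "'y \<Rightarrow> 'e::euclidean_space"
  assumes "finite_measure \<mu>" "finite_measure \<nu>"
    and \<phi>: "integrable \<mu> \<phi>" "integrable \<nu> \<phi>"
  shows kernel_integrable_inner: "kernel_integrable (\<lambda>y y'. \<phi> y \<bullet> \<phi> y') \<mu> \<nu>"
    and kernel_integral_inner:
      "kernel_integral (\<lambda>y y'. \<phi> y \<bullet> \<phi> y') \<mu> \<nu> = (\<integral>y. \<phi> y \<partial>\<mu>) \<bullet> (\<integral>y. \<phi> y \<partial>\<nu>)"
proof -
  interpret \<mu>: finite_measure \<mu> by fact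
  interpret \<nu>: finite_measure \<nu> by fact
  interpret pair_sigma_finite \<mu> \<nu> ..
  have [measurable]: "\<phi> \<in> borel_measurable \<mu>" "\<phi> \<in> borel_measurable \<nu>" using \<phi> by auto
  have int: "integrable (\<mu> \<Otimes>\<^sub>M \<nu>) (\<lambda>z. \<phi> (fst z) \<bullet> \<phi> (snd z))"
  proof (rule Bochner_Integration.integrable_bound)
    show "integrable (\<mu> \<Otimes>\<^sub>M \<nu>) (\<lambda>z. norm (\<phi> (fst z)) * norm (\<phi> (snd z)))"
      using \<phi> by (intro Fubini_integrable) (auto intro!: integrable_mult_right integrable_mult_left)
    show "AE z in \<mu> \<Otimes>\<^sub>M \<nu>. norm (\<phi> (fst z) \<bullet> \<phi> (snd z)) \<le> norm (norm (\<phi> (fst z)) * norm (\<phi> (snd z)))"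
      using Cauchy_Schwarz_ineq2 by (auto intro!: AE_I2)
  qed measurable
  then show "kernel_integrable (\<lambda>y y'. \<phi> y \<bullet> \<phi> y') \<mu> \<nu>" by (simp add: kernel_integrable_def)
  have "kernel_integral (\<lambda>y y'. \<phi> y \<bullet> \<phi> y') \<mu> \<nu> = (\<integral>y. (\<integral>y'. \<phi> y \<bullet> \<phi> y' \<partial>\<nu>) \<partial>\<mu>)"
    unfolding kernel_integral_def using integral_fst'[OF int] by simp
  also have "\<dots> = (\<integral>y. \<phi> y \<partial>\<mu>) \<bullet> (\<integral>y. \<phi> y \<partial>\<nu>)"
    using \<phi> by simp
  finally show "kernel_integral (\<lambda>y y'. \<phi> y \<bullet> \<phi> y') \<mu> \<nu> = (\<integral>y. \<phi> y \<partial>\<mu>) \<bullet> (\<integral>y. \<phi> y \<partial>\<nu>)" .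
qed

lemma pd_kernel_inner:
  fixes \<phi> :: "'y \<Rightarrow> 'e::euclidean_space"
  assumes [measurable]: "\<phi> \<in> borel_measurable M"
  shows "pd_kernel M (\<lambda>y y'. \<phi> y \<bullet> \<phi> y')"
  unfolding pd_kernel_def
proof (intro conjI allI impI ballI)
  fix m :: nat and y :: "nat \<Rightarrow> 'y" and c :: "nat \<Rightarrow> real"
  have "(\<Sum>i<m. \<Sum>j<m. c i * c j * (\<phi> (y i) \<bullet> \<phi> (y j)))
      = (\<Sum>i<m. c i *\<^sub>R \<phi> (y i)) \<bullet> (\<Sum>j<m. c j *\<^sub>R \<phi> (y j))"
    by (simp only: inner_sum_left) (simp add: inner_sum_right sum_distrib_left mult_ac)
  then show "0 \<le> (\<Sum>i<m. \<Sum>j<m. c i * c j * (\<phi> (y i) \<bullet> \<phi> (y j)))" by simp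
qed (measurable, simp add: inner_commute)

text \<open>On a finite space the mean feature vector is the combination of the vectors
  \<open>\<phi> y\<close> with the point masses as coefficients; by linear independence it
  determines the measure.\<close>

lemma integrally_strictly_pd_feature_map:
  fixes \<phi> :: "'f::finite \<Rightarrow> 'e::euclidean_space"
  assumes \<phi>: "injective_feature_map \<phi>"
  shows "integrally_strictly_pd (count_space UNIV) (\<lambda>y y'. \<phi> y \<bullet> \<phi> y')"
  unfolding integrally_strictly_pd_def
proof (intro conjI allI impI; (elim conjE)?)
  show "pd_kernel (count_space UNIV) (\<lambda>y y'. \<phi> y \<bullet> \<phi> y')" by (rule pd_kernel_inner) simp
  fix \<mu> \<nu> :: "'f measure"
  assume fin: "finite_measure \<mu>" "finite_measure \<nu>"
    and sets: "sets \<mu> = sets (count_space UNIV)" "sets \<nu> = sets (count_space UNIV)" and neq: "\<mu> \<noteq> \<nu>"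
  have int: "integrable \<kappa> \<phi>" and eq: "(\<integral>y. \<phi> y \<partial>\<kappa>) = (\<Sum>y\<in>UNIV. measure \<kappa> {y} *\<^sub>R \<phi> y)"
    if "finite_measure \<kappa>" "sets \<kappa> = sets (count_space UNIV)" for \<kappa>
  proof -
    interpret finite_measure \<kappa> by fact
    have "indicator {y} x *\<^sub>R \<phi> y = (if x = y then \<phi> y else 0)" for x y
      by (simp add: indicator_def)
    then have \<phi>_eq: "\<phi> = (\<lambda>x. \<Sum>y\<in>UNIV. indicator {y} x *\<^sub>R \<phi> y)" by simp
    have ind: "integrable \<kappa> (indicator {y} :: 'f \<Rightarrow> real)" for y
      using that by (intro integrable_real_indicator) (auto simp: less_top[symmetric])
    then have *: "integrable \<kappa> (\<lambda>x. indicator {y} x *\<^sub>R \<phi> y)" for y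
      by (intro integrable_scaleR_left)
    show "integrable \<kappa> \<phi>" by (subst \<phi>_eq) (intro Bochner_Integration.integrable_sum *)
    have "space \<kappa> = UNIV" using sets_eq_imp_space_eq[OF that(2)] by simp
    then have "(\<Sum>y\<in>UNIV. measure \<kappa> {y} *\<^sub>R \<phi> y) = (\<Sum>y\<in>UNIV. \<integral>x. indicator {y} x *\<^sub>R \<phi> y \<partial>\<kappa>)"
      using that(2) by (simp add: ind)
    also have "\<dots> = (\<integral>x. (\<Sum>y\<in>UNIV. indicator {y} x *\<^sub>R \<phi> y) \<partial>\<kappa>)"
      using * by (rule Bochner_Integration.integral_sum[symmetric])
    finally show "(\<integral>y. \<phi> y \<partial>\<kappa>) = (\<Sum>y\<in>UNIV. measure \<kappa> {y} *\<^sub>R \<phi> y)"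
      by (simp flip: \<phi>_eq)
  qed
  note int_\<mu> = int[OF fin(1) sets(1)] and int_\<nu> = int[OF fin(2) sets(2)]
  show "kernel_integrable (\<lambda>y y'. \<phi> y \<bullet> \<phi> y') \<mu> \<mu>" "kernel_integrable (\<lambda>y y'. \<phi> y \<bullet> \<phi> y') \<mu> \<nu>"
    "kernel_integrable (\<lambda>y y'. \<phi> y \<bullet> \<phi> y') \<nu> \<mu>" "kernel_integrable (\<lambda>y y'. \<phi> y \<bullet> \<phi> y') \<nu> \<nu>"
    using fin int_\<mu> int_\<nu> by (auto intro: kernel_integrable_inner)
  have "(\<integral>y. \<phi> y \<partial>\<mu>) \<noteq> (\<integral>y. \<phi> y \<partial>\<nu>)"
  proof
    assume "(\<integral>y. \<phi> y \<partial>\<mu>) = (\<integral>y. \<phi> y \<partial>\<nu>)"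
    then have "(\<Sum>y\<in>UNIV. (measure \<mu> {y} - measure \<nu> {y}) *\<^sub>R \<phi> y) = 0"
      by (simp add: eq fin sets scaleR_diff_left sum_subtractf)
    \<comment> \<open>\<open>dependent_finite\<close> speaks of coefficients attached to vectors, so
      the sum is reindexed along the injective \<open>\<phi>\<close>.\<close>
    also have "(\<Sum>y\<in>UNIV. (measure \<mu> {y} - measure \<nu> {y}) *\<^sub>R \<phi> y)
        = (\<Sum>v\<in>range \<phi>. (measure \<mu> {inv \<phi> v} - measure \<nu> {inv \<phi> v}) *\<^sub>R v)"
      using \<phi> by (subst sum.reindex) (auto simp: injective_feature_map_def)
    finally have zero: "(\<Sum>v\<in>range \<phi>. (measure \<mu> {inv \<phi> v} - measure \<nu> {inv \<phi> v}) *\<^sub>R v) = 0" .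
    have "inj \<phi>" "\<not> dependent (range \<phi>)" using \<phi> by (simp_all add: injective_feature_map_def)
    then have "measure \<mu> {y} = measure \<nu> {y}" for y
      using zero unfolding dependent_finite[of "range \<phi>", simplified]
      by (auto dest!: spec[of _ "\<lambda>v. measure \<mu> {inv \<phi> v} - measure \<nu> {inv \<phi> v}"])
    then have "emeasure \<mu> {y} = emeasure \<nu> {y}" for y
      using fin by (simp add: finite_measure.emeasure_eq_measure)
    then have "\<mu> = \<nu>" using sets by (intro measure_eqI_finite[of _ UNIV]) auto
    with neq show False ..
  qed
  then have "0 < ((\<integral>y. \<phi> y \<partial>\<mu>) - (\<integral>y. \<phi> y \<partial>\<nu>)) \<bullet> ((\<integral>y. \<phi> y \<partial>\<mu>) - (\<integral>y. \<phi> y \<partial>\<nu>))" by simp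
  also have "\<dots> = kernel_integral (\<lambda>y y'. \<phi> y \<bullet> \<phi> y') \<mu> \<mu> - kernel_integral (\<lambda>y y'. \<phi> y \<bullet> \<phi> y') \<mu> \<nu>
      - kernel_integral (\<lambda>y y'. \<phi> y \<bullet> \<phi> y') \<nu> \<mu> + kernel_integral (\<lambda>y y'. \<phi> y \<bullet> \<phi> y') \<nu> \<nu>"
    using fin int_\<mu> int_\<nu> by (simp add: kernel_integral_inner algebra_simps)
  finally show "0 < kernel_integral (\<lambda>y y'. \<phi> y \<bullet> \<phi> y') \<mu> \<mu> - kernel_integral (\<lambda>y y'. \<phi> y \<bullet> \<phi> y') \<mu> \<nu>
      - kernel_integral (\<lambda>y y'. \<phi> y \<bullet> \<phi> y') \<nu> \<mu> + kernel_integral (\<lambda>y y'. \<phi> y \<bullet> \<phi> y') \<nu> \<nu>" .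
qed

text \<open>A dependence \<open>\<Sum>\<^sub>a c\<^sub>a E\<^sub>a[y] = 0\<close> between the mean posteriors, tested against the vector
  \<open>(c\<^sub>b / q\<^sub>b)\<^sub>b\<close>, becomes the sum over \<open>y\<close> of \<open>(\<Sum>\<^sub>a c\<^sub>a P(y, a))\<^sup>2\<close> divided by the evidence of \<open>y\<close>.\<close>

lemma pseudo_posterior_gram_positive:
  fixes q :: "'d::finite pmf" and P :: "'d \<Rightarrow> (real^'d) measure"
  assumes q: "\<And>a. 0 < pmf q a"
    and indep: "P \<in> P_indep (count_space UNIV)" and post: "P \<in> P_pseudo_posterior q"
  shows "gram_positive (\<lambda>y y'. y \<bullet> y') P"
  unfolding gram_positive_def
proof (intro allI impI)
  fix c :: "'d \<Rightarrow> real" assume c: "\<exists>a. c a \<noteq> 0"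
  obtain p :: "'d \<Rightarrow> (real^'d) pmf" where p: "P = (\<lambda>a. measure_pmf (p a))"
    and p_post: "\<And>y. \<exists>a. 0 < pmf (p a) y \<Longrightarrow>
      y = (\<chi> a. pmf (p a) y * pmf q a / (\<Sum>a'\<in>UNIV. pmf (p a') y * pmf q a'))"
    using post unfolding P_pseudo_posterior_def by blast
  define Z where "Z y = (\<Sum>a\<in>UNIV. pmf (p a) y * pmf q a)" for y
  have Z: "0 \<le> Z y" for y unfolding Z_def by (intro sum_nonneg) auto
  have le_Z: "pmf (p a) y * pmf q a \<le> Z y" for a y
    unfolding Z_def by (rule member_le_sum) auto
  have comp: "y $ b = pmf (p b) y * pmf q b / Z y" if "0 < pmf (p a) y" for a b y
    using p_post[of y] that unfolding Z_def by (metis (no_types, lifting) vec_lambda_beta)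
  have comp_le: "\<bar>y $ b\<bar> \<le> 1" if "0 < pmf (p a) y" for a b y
    using comp[OF that] le_Z[of b y] Z[of y] by (simp add: divide_le_eq)
  have bound: "AE y in p a. norm y \<le> real CARD('d)" for a
  proof (rule AE_pmfI)
    fix y assume "y \<in> set_pmf (p a)"
    then have "0 < pmf (p a) y" by (simp add: pmf_positive)
    then have "(\<Sum>b\<in>UNIV. \<bar>y $ b\<bar>) \<le> (\<Sum>b\<in>(UNIV::'d set). 1)"
      by (intro sum_mono comp_le)
    with norm_le_l1_cart[of y] show "norm y \<le> real CARD('d)" by simp
  qed
  have int: "integrable (p a) (\<lambda>y. y)" for a
    using bound by (rule measure_pmf.integrable_const_bound) simp
  define V where "V = (\<Sum>a\<in>UNIV. c a *\<^sub>R (\<integral>y. y \<partial>p a))"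
  have "V \<noteq> 0"
  proof
    assume V: "V = 0"
    define u :: "real^'d" where "u = (\<chi> b. c b / pmf q b)"
    define g where "g y = (\<Sum>a\<in>UNIV. c a * pmf (p a) y)" for y
    \<comment> \<open>The Bayes form gives \<open>y \<bullet> u = g y / Z y\<close> only for
      observations of positive probability; the extra factor \<open>g y\<close> vanishes at all
      other points.\<close>
    have gu: "g y * (y \<bullet> u) = g y * (g y / Z y)" for y
    proof (cases "\<exists>a. 0 < pmf (p a) y")
      case True
      then obtain a where "0 < pmf (p a) y" ..
      then have "y \<bullet> u = (\<Sum>b\<in>UNIV. c b * pmf (p b) y / Z y)"
        using q by (simp add: inner_vec_def u_def comp less_imp_neq[symmetric] mult.commute)
      then show ?thesis by (simp add: g_def sum_divide_distrib)
    next
      case False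
      then have "pmf (p a) y = 0" for a using pmf_nonneg[of "p a" y] by (metis less_le)
      then show ?thesis by (simp add: g_def)
    qed
    have int_u: "integrable (count_space UNIV) (\<lambda>y. c a * (pmf (p a) y * (y \<bullet> u)))" for a
    proof -
      have "integrable (p a) (\<lambda>y. y \<bullet> u)" using int by simp
      then have "integrable (count_space UNIV) (\<lambda>y. pmf (p a) y * (y \<bullet> u))"
        unfolding measure_pmf_eq_density by (subst (asm) integrable_density) auto
      then show ?thesis by simp
    qed
    have "0 = V \<bullet> u" using V by simp
    also have "\<dots> = (\<Sum>a\<in>UNIV. c a * (\<integral>y. y \<bullet> u \<partial>p a))"
      using int by (simp add: V_def inner_sum_left)
    \<comment> \<open>All the \<open>p a\<close> are moved to the counting measure as a common
      reference, so that the sum over labels can go under the integral.\<close>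
    also have "\<dots> = (\<Sum>a\<in>UNIV. \<integral>y. c a * (pmf (p a) y * (y \<bullet> u)) \<partial>count_space UNIV)"
      unfolding measure_pmf_eq_density by (simp add: integral_density)
    also have "\<dots> = (\<integral>y. (\<Sum>a\<in>UNIV. c a * (pmf (p a) y * (y \<bullet> u))) \<partial>count_space UNIV)"
      using int_u by (simp add: Bochner_Integration.integral_sum del: integral_mult_right_zero)
    also have "(\<lambda>y. \<Sum>a\<in>UNIV. c a * (pmf (p a) y * (y \<bullet> u))) = (\<lambda>y. g y * (g y / Z y))"
      unfolding gu[symmetric] by (simp add: g_def sum_distrib_right mult.assoc)
    finally have zero: "(\<integral>y. g y * (g y / Z y) \<partial>count_space UNIV) = 0" ..
    have "integrable (count_space UNIV) (\<lambda>y. \<Sum>a\<in>UNIV. c a * (pmf (p a) y * (y \<bullet> u)))"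
      using int_u by (rule Bochner_Integration.integrable_sum)
    also have "(\<lambda>y. \<Sum>a\<in>UNIV. c a * (pmf (p a) y * (y \<bullet> u))) = (\<lambda>y. g y * (g y / Z y))"
      unfolding gu[symmetric] by (simp add: g_def sum_distrib_right mult.assoc)
    finally have "AE y in count_space UNIV. g y * (g y / Z y) = 0"
      using zero Z by (subst (asm) integral_nonneg_eq_0_iff_AE) auto
    then have g0: "g y = 0" for y
    proof -
      assume "AE y in count_space UNIV. g y * (g y / Z y) = 0"
      \<comment> \<open>Almost everywhere for the counting measure means everywhere. By full support
        of \<open>q\<close>, zero evidence at \<open>y\<close> means zero probability under every
        label.\<close>
      then have "g y = 0 \<or> Z y = 0" by (auto simp: AE_count_space)
      moreover have "pmf (p a) y = 0" if "Z y = 0" for a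
        using le_Z[of a y] q[of a] that pmf_nonneg[of "p a" y]
        by (simp add: mult_le_0_iff)
      ultimately show "g y = 0" by (auto simp: g_def)
    qed
    have "(\<Sum>a\<in>UNIV. c a * measure (P a) A) = 0" for A
    proof -
      have int_A: "integrable (count_space UNIV) (\<lambda>y. c a * (pmf (p a) y * indicator A y))" for a
      proof -
        have "integrable (p a) (indicator A :: _ \<Rightarrow> real)"
          by (rule measure_pmf.integrable_const_bound[where B = 1]) (auto simp: indicator_def)
        then have "integrable (count_space UNIV) (\<lambda>y. pmf (p a) y * indicator A y)"
          unfolding measure_pmf_eq_density by (subst (asm) integrable_density) auto
        then show ?thesis by simp
      qed
      have "(\<Sum>a\<in>UNIV. c a * measure (P a) A) = (\<Sum>a\<in>UNIV. c a * (\<integral>y. indicator A y \<partial>p a))"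
        by (simp add: p)
      also have "\<dots> = (\<Sum>a\<in>UNIV. \<integral>y. c a * (pmf (p a) y * indicator A y) \<partial>count_space UNIV)"
        unfolding measure_pmf_eq_density by (subst integral_density) auto
      also have "\<dots> = (\<integral>y. (\<Sum>a\<in>UNIV. c a * (pmf (p a) y * indicator A y)) \<partial>count_space UNIV)"
        using int_A by (simp add: Bochner_Integration.integral_sum del: integral_mult_right_zero)
      also have "(\<lambda>y. \<Sum>a\<in>UNIV. c a * (pmf (p a) y * indicator A y)) = (\<lambda>y. g y * indicator A y)"
        by (simp add: g_def sum_distrib_right mult.assoc)
      finally show ?thesis by (simp add: g0)
    qed
    then have "\<forall>a. c a = 0" using indep by (simp add: P_indep_def)
    with c show False by simp
  qed
  have "V \<bullet> V = (\<Sum>a\<in>UNIV. \<Sum>b\<in>UNIV. c a * c b * ((\<integral>y. y \<partial>p a) \<bullet> (\<integral>y. y \<partial>p b)))"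
    unfolding V_def by (simp only: inner_sum_left) (simp add: inner_sum_right sum_distrib_left mult_ac)
  also have "\<dots> = (\<Sum>a\<in>UNIV. \<Sum>b\<in>UNIV. c a * c b * kernel_integral (\<lambda>y y'. y \<bullet> y') (P a) (P b))"
    using int by (simp add: p kernel_integral_inner[where \<phi> = "\<lambda>y. y"] measure_pmf.finite_measure_axioms)
  finally have "(\<Sum>a\<in>UNIV. \<Sum>b\<in>UNIV. c a * c b * kernel_integral (\<lambda>y y'. y \<bullet> y') (P a) (P b)) = V \<bullet> V" ..
  with \<open>V \<noteq> 0\<close> show "0 < (\<Sum>a\<in>UNIV. \<Sum>b\<in>UNIV. c a * c b * kernel_integral (\<lambda>y y'. y \<bullet> y') (P a) (P b))"
    by simp
qed

section \<open>A functional monotone class theorem\<close>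

text \<open>Closure under linear combinations and uniformly bounded pointwise limits, given
  inductively so that identities between integrals pass from \<open>F\<close> to the whole class by
  rule induction and dominated convergence.\<close>

inductive_set bounded_class :: "('a \<Rightarrow> real) set \<Rightarrow> ('a \<Rightarrow> real) set" for F where
  base: "f \<in> F \<Longrightarrow> f \<in> bounded_class F"
| add: "f \<in> bounded_class F \<Longrightarrow> g \<in> bounded_class F \<Longrightarrow> (\<lambda>x. f x + g x) \<in> bounded_class F"
| scale: "f \<in> bounded_class F \<Longrightarrow> (\<lambda>x. c * f x) \<in> bounded_class F"
| lim: "(\<And>n :: nat. f n \<in> bounded_class F) \<Longrightarrow> (\<And>n x. \<bar>f n x\<bar> \<le> B) \<Longrightarrow>
    (\<And>x. (\<lambda>n. f n x) \<longlonglongrightarrow> g x) \<Longrightarrow> g \<in> bounded_class F"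

text \<open>Products of generators have to lie only in the generated class: products of sines and
  cosines are linear combinations of generators, not generators.\<close>

locale multiplicative_family =
  fixes F :: "('a \<Rightarrow> real) set"
  assumes one: "(\<lambda>_. 1) \<in> F"
    and bounded: "f \<in> F \<Longrightarrow> \<exists>B. \<forall>x. \<bar>f x\<bar> \<le> B"
    and times: "f \<in> F \<Longrightarrow> g \<in> F \<Longrightarrow> (\<lambda>x. f x * g x) \<in> bounded_class F"
begin

lemma class_bounded: "f \<in> bounded_class F \<Longrightarrow> \<exists>B. \<forall>x. \<bar>f x\<bar> \<le> B"
proof (induction rule: bounded_class.induct)
  case (add f g)
  then obtain B C where "\<And>x. \<bar>f x\<bar> \<le> B" "\<And>x. \<bar>g x\<bar> \<le> C" by blast
  then show ?case by (intro exI[of _ "B + C"]) (meson abs_triangle_ineq add_mono order_trans)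
next
  case (scale f c)
  then obtain B where "\<And>x. \<bar>f x\<bar> \<le> B" by blast
  then show ?case by (intro exI[of _ "\<bar>c\<bar> * B"]) (simp add: abs_mult mult_left_mono)
next
  case (lim f B g)
  have "\<bar>g x\<bar> \<le> B" for x
    using lim.hyps(3)[of x] lim.hyps(2) by (intro LIMSEQ_le_const2[OF tendsto_rabs]) auto
  then show ?case by blast
qed (rule bounded)

lemma class_const: "(\<lambda>_. c) \<in> bounded_class F"
  using bounded_class.scale[OF bounded_class.base[OF one], of c] by simp

lemma class_diff:
  assumes "f \<in> bounded_class F" "g \<in> bounded_class F"
  shows "(\<lambda>x. f x - g x) \<in> bounded_class F"
  using bounded_class.add[OF assms(1) bounded_class.scale[OF assms(2), of "-1"]] by simp

text \<open>One bootstrapping step with a frozen factor \<open>f\<close>. \<open>class_times\<close>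
  applies it twice: first with a generator frozen, then with an arbitrary member of the
  class.\<close>

lemma class_times_aux:
  assumes g: "g \<in> bounded_class F" and f: "\<exists>B. \<forall>x. \<bar>f x\<bar> \<le> B"
    and base: "\<And>g. g \<in> F \<Longrightarrow> (\<lambda>x. f x * g x) \<in> bounded_class F"
  shows "(\<lambda>x. f x * g x) \<in> bounded_class F"
  using g
proof (induction rule: bounded_class.induct)
  case (add g h)
  then show ?case by (simp add: distrib_left bounded_class.add)
next
  case (scale g c)
  have "(\<lambda>x. f x * (c * g x)) = (\<lambda>x. c * (f x * g x))" by (simp add: fun_eq_iff)
  then show ?case using bounded_class.scale[OF scale(2), of c] by simp
next
  case (lim g B h)
  obtain C where C: "\<And>x. \<bar>f x\<bar> \<le> C" using f by blast
  have "\<bar>f x * g n x\<bar> \<le> C * B" for n x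
    unfolding abs_mult using C[of x] lim.hyps(2)[of n x] by (intro mult_mono) (auto intro: order_trans[OF abs_ge_zero])
  then show ?case
    by (rule bounded_class.lim[OF lim.IH]) (rule tendsto_mult_left[OF lim.hyps(3)])
qed (rule base)

lemma class_times:
  assumes "f \<in> bounded_class F" "g \<in> bounded_class F"
  shows "(\<lambda>x. f x * g x) \<in> bounded_class F"
proof (rule class_times_aux[OF assms(2) class_bounded[OF assms(1)]])
  fix h assume "h \<in> F"
  then have "(\<lambda>x. h x * f x) \<in> bounded_class F"
    by (intro class_times_aux[OF assms(1)] bounded times)
  then show "(\<lambda>x. f x * h x) \<in> bounded_class F" by (simp add: mult.commute)
qed

lemma class_power: "f \<in> bounded_class F \<Longrightarrow> (\<lambda>x. f x ^ n) \<in> bounded_class F"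
  by (induction n) (auto intro: class_const class_times)

lemma class_sum:
  assumes "\<And>i. i \<in> I \<Longrightarrow> f i \<in> bounded_class F"
  shows "(\<lambda>x. \<Sum>i\<in>I. f i x) \<in> bounded_class F"
  using assms by (induction I rule: infinite_finite_induct) (auto intro: class_const bounded_class.add)

lemma class_prod:
  assumes "\<And>i. i \<in> I \<Longrightarrow> f i \<in> bounded_class F"
  shows "(\<lambda>x. \<Prod>i\<in>I. f i x) \<in> bounded_class F"
  using assms by (induction I rule: infinite_finite_induct) (auto intro: class_const class_times)

text \<open>Bernstein polynomials approximate \<open>h\<close> and, being averages of its values,
  obey the same bound \<open>B\<close> for every degree, as the rule \<open>lim\<close>
  requires.\<close>

lemma class_continuous:
  assumes f: "f \<in> bounded_class F" "\<And>x. f x \<in> {0..1}"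
    and h: "continuous_on {0..1} h" "\<And>t. \<bar>h t\<bar> \<le> B"
  shows "(\<lambda>x. h (f x)) \<in> bounded_class F"
proof (rule bounded_class.lim)
  let ?p = "\<lambda>n x. \<Sum>k\<le>n. h (real k / real n) * Bernstein n k (f x)"
  show "?p n \<in> bounded_class F" for n
    unfolding Bernstein_def
    by (intro class_sum class_times class_const class_power class_diff f(1))
  show "\<bar>?p n x\<bar> \<le> B" for n x
  proof -
    have "\<bar>?p n x\<bar> \<le> (\<Sum>k\<le>n. B * Bernstein n k (f x))"
      using f(2)[of x] h(2)
      by (intro order_trans[OF sum_abs] sum_mono) (simp add: abs_mult Bernstein_nonneg mult_right_mono)
    then show ?thesis by (simp flip: sum_distrib_left)
  qed
  show "(\<lambda>n. ?p n x) \<longlonglongrightarrow> h (f x)" for x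
  proof (rule LIMSEQ_I)
    fix e :: real assume "0 < e"
    from Bernstein_Weierstrass[OF h(1) this] f(2)[of x]
    obtain N where "\<And>n. N \<le> n \<Longrightarrow> \<bar>h (f x) - ?p n x\<bar> < e" by blast
    then show "\<exists>N. \<forall>n\<ge>N. norm (?p n x - h (f x)) < e"
      by (auto simp: abs_minus_commute)
  qed
qed

text \<open>Clipped linear ramps of slope \<open>n\<close> starting at \<open>c\<close> converge to
  the indicator; they all vanish at \<open>c\<close> itself, hence the strict inequality.\<close>

lemma class_indicator_greater:
  assumes f: "f \<in> bounded_class F" "\<And>x. f x \<in> {0..1}"
  shows "indicator {x. c < f x} \<in> bounded_class F"
proof (rule bounded_class.lim)
  let ?h = "\<lambda>n t. min 1 (max 0 (real n * (t - c)))"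
  show "(\<lambda>x. ?h n (f x)) \<in> bounded_class F" for n
    by (rule class_continuous[OF f, of _ 1]) (auto intro!: continuous_intros)
  show "\<bar>?h n (f x)\<bar> \<le> 1" for n x by auto
  show "(\<lambda>n. ?h n (f x)) \<longlonglongrightarrow> indicator {x. c < f x} x" for x
  proof (cases "c < f x")
    case True
    obtain N where N: "1 < real N * (f x - c)"
      using ex_less_of_nat_mult[of "f x - c" 1] True by auto
    have "?h n (f x) = 1" if "N \<le> n" for n
    proof -
      have "real N * (f x - c) \<le> real n * (f x - c)" using that True by (intro mult_right_mono) auto
      with N show ?thesis by simp
    qed
    then have "\<forall>\<^sub>F n in sequentially. ?h n (f x) = 1" by (auto simp: eventually_sequentially)
    then show ?thesis using True by (simp add: tendsto_eventually)
  next
    case False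
    then have "?h n (f x) = 0" for n by (simp add: mult_nonneg_nonpos)
    then show ?thesis using False by simp
  qed
qed

definition class_sets :: "'a set set" where
  "class_sets = {A. indicator A \<in> bounded_class F}"

text \<open>Finite products of indicators are bounded by 1 and converge to the indicator of a
  countable intersection; unions follow by complements.\<close>

lemma sigma_algebra_class_sets: "sigma_algebra UNIV class_sets"
  unfolding sigma_algebra_iff2
proof (intro conjI ballI allI impI)
  have ind0: "indicator {} = (\<lambda>_::'a. 0::real)" by (simp add: fun_eq_iff)
  show "{} \<in> class_sets" using class_const[of 0] unfolding class_sets_def by (simp add: ind0)
  have compl: "indicator (- A) = (\<lambda>x. 1 - indicator A x :: real)" for A :: "'a set"
    by (auto simp: indicator_def)
  have compl': "UNIV - A \<in> class_sets" if "A \<in> class_sets" for A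
    using that class_diff[OF class_const[of 1]] by (auto simp: class_sets_def compl simp flip: Compl_eq_Diff_UNIV)
  then show "UNIV - A \<in> class_sets" if "A \<in> class_sets" for A using that .
  fix A :: "nat \<Rightarrow> 'a set" assume A: "range A \<subseteq> class_sets"
  have "indicator (\<Inter>i. - A i) \<in> bounded_class F"
  proof (rule bounded_class.lim)
    let ?f = "\<lambda>n x. \<Prod>i<n. indicator (- A i) x :: real"
    show "?f n \<in> bounded_class F" for n
      using A compl' by (intro class_prod) (auto simp: class_sets_def Compl_eq_Diff_UNIV)
    show "\<bar>?f n x\<bar> \<le> 1" for n x
      unfolding abs_prod by (intro prod_le_1) (auto simp: indicator_def)
    show "(\<lambda>n. ?f n x) \<longlonglongrightarrow> indicator (\<Inter>i. - A i) x" for x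
    proof (cases "\<exists>i. x \<in> A i")
      case True
      then obtain i where "x \<in> A i" ..
      then have "?f n x = 0" if "i < n" for n using that by (intro prod_zero) (auto intro!: bexI[of _ i])
      then have "\<forall>\<^sub>F n in sequentially. ?f n x = 0"
        by (auto simp: eventually_sequentially intro!: exI[of _ "Suc i"])
      then show ?thesis using True by (simp add: tendsto_eventually)
    qed simp
  qed
  then have "UNIV - (\<Inter>i. - A i) \<in> class_sets" by (intro compl') (simp add: class_sets_def)
  also have "UNIV - (\<Inter>i. - A i) = (\<Union>i. A i)" by auto
  finally show "(\<Union>i. A i) \<in> class_sets" .
qed simp

lemma sets_class_sets: "sets (sigma UNIV class_sets) = class_sets"
  using sigma_algebra_class_sets by (rule sigma_algebra.sets_measure_of_eq)

text \<open>An affine rescaling into the unit interval turns superlevel sets of \<open>f\<close>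
  into those handled by \<open>class_indicator_greater\<close>; \<open>max B 1\<close> keeps the
  scale positive.\<close>

lemma class_measurable:
  assumes f: "f \<in> bounded_class F"
  shows "f \<in> borel_measurable (sigma UNIV class_sets)"
  unfolding borel_measurable_iff_greater sets_class_sets
proof
  fix c
  obtain B where B: "\<And>x. \<bar>f x\<bar> \<le> B" using class_bounded[OF f] by blast
  define C where "C = max B 1"
  have C: "\<bar>f x\<bar> \<le> C" "0 < C" for x using B[of x] by (auto simp: C_def)
  define g where "g x = 1 / (2 * C) * (f x + C)" for x
  have g_iff: "(c + C) / (2 * C) < g x \<longleftrightarrow> c < f x" for x
    using C(2) by (simp add: g_def divide_less_cancel)
  have "g \<in> bounded_class F"
    unfolding g_def[abs_def] by (intro bounded_class.scale bounded_class.add f class_const)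
  moreover have "g x \<in> {0..1}" for x
    using C(1)[of x] C(2) by (auto simp: g_def field_simps abs_le_iff)
  ultimately have "indicator {x. (c + C) / (2 * C) < g x} \<in> bounded_class F"
    by (rule class_indicator_greater)
  then show "{x \<in> space (sigma UNIV class_sets). c < f x} \<in> class_sets"
    by (simp add: class_sets_def g_iff)
qed

end

text \<open>Integrability is carried through the induction along with the equality, since sums and
  limits need it; at a limit the constant \<open>B\<close> dominates, which is integrable for finite
  measures.\<close>

lemma bounded_class_integral:
  assumes fin: "finite_measure \<mu>" "finite_measure \<nu>" and sets: "sets \<mu> = sets N" "sets \<nu> = sets N"
    and F: "\<And>f. f \<in> F \<Longrightarrow> f \<in> borel_measurable N" "\<And>f. f \<in> F \<Longrightarrow> \<exists>B. \<forall>x. \<bar>f x\<bar> \<le> B"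
      "\<And>f. f \<in> F \<Longrightarrow> (\<integral>x. f x \<partial>\<mu>) = (\<integral>x. f x \<partial>\<nu>)"
    and f: "f \<in> bounded_class F"
  shows "(\<integral>x. f x \<partial>\<mu>) = (\<integral>x. f x \<partial>\<nu>)"
proof -
  have "integrable \<mu> f \<and> integrable \<nu> f \<and> (\<integral>x. f x \<partial>\<mu>) = (\<integral>x. f x \<partial>\<nu>)"
    using f
  proof (induction rule: bounded_class.induct)
    case (base f)
    obtain B where B: "\<And>x. \<bar>f x\<bar> \<le> B" using F(2)[OF base] by blast
    have m: "f \<in> borel_measurable \<mu>" "f \<in> borel_measurable \<nu>"
      using F(1)[OF base] sets by (simp_all cong: measurable_cong_sets)
    have "integrable \<mu> f"
      using B m by (intro finite_measure.integrable_const_bound[OF fin(1), of _ B]) auto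
    moreover have "integrable \<nu> f"
      using B m by (intro finite_measure.integrable_const_bound[OF fin(2), of _ B]) auto
    ultimately show ?case using F(3)[OF base] by simp
  next
    case (lim f B g)
    have limit: "integrable \<kappa> g" "(\<lambda>n. \<integral>x. f n x \<partial>\<kappa>) \<longlonglongrightarrow> (\<integral>x. g x \<partial>\<kappa>)"
      if "finite_measure \<kappa>" "\<And>n. integrable \<kappa> (f n)" for \<kappa>
    proof -
      interpret finite_measure \<kappa> by fact
      have [measurable]: "f n \<in> borel_measurable \<kappa>" for n using that(2) by auto
      have "g \<in> borel_measurable \<kappa>"
        by (rule borel_measurable_LIMSEQ_real[where u = f]) (auto intro: lim.hyps)
      moreover have "norm (f n x) \<le> B" "(\<lambda>n. f n x) \<longlonglongrightarrow> g x" for n x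
        using lim.hyps(2)[of n x] lim.hyps(3)[of x] by simp_all
      ultimately show "integrable \<kappa> g" "(\<lambda>n. \<integral>x. f n x \<partial>\<kappa>) \<longlonglongrightarrow> (\<integral>x. g x \<partial>\<kappa>)"
        by (auto intro!: integrable_dominated_convergence[where s = f and w = "\<lambda>_. B"]
            integral_dominated_convergence[where w = "\<lambda>_. B"])
    qed
    note int = lim.IH[THEN conjunct1] lim.IH[THEN conjunct2, THEN conjunct1]
    have "(\<integral>x. g x \<partial>\<mu>) = (\<integral>x. g x \<partial>\<nu>)"
      using limit(2)[OF fin(1) int(1)] limit(2)[OF fin(2) int(2)]
      unfolding lim.IH[THEN conjunct2, THEN conjunct2] by (rule LIMSEQ_unique)
    then show ?case using limit(1)[OF fin(1) int(1)] limit(1)[OF fin(2) int(2)] by simp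
  qed auto
  then show ?thesis by simp
qed

text \<open>The constant coefficient is the limit at 0; once it is gone, division by
  \<open>t\<close> shifts the series. Restricting the hypothesis to nonzero \<open>t\<close> makes
  it stable under this division.\<close>

lemma powser_zero_imp_coeff_zero:
  fixes a :: "nat \<Rightarrow> real"
  assumes "\<And>t. t \<noteq> 0 \<Longrightarrow> (\<lambda>n. a n * t ^ n) sums 0"
  shows "a n = 0"
  using assms
proof (induction n arbitrary: a)
  case 0
  have "((\<lambda>_. 0) \<longlongrightarrow> a 0) (at (0::real))"
    by (rule powser_limit_0_strong[of 1]) (auto intro: 0)
  then show ?case using LIM_unique[OF _ tendsto_const] by fastforce
next
  case (Suc n)
  have "((\<lambda>_. 0) \<longlongrightarrow> a 0) (at (0::real))"
    by (rule powser_limit_0_strong[of 1]) (auto intro: Suc)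
  then have a0: "a 0 = 0" using LIM_unique[OF _ tendsto_const] by fastforce
  have "(\<lambda>n. a (Suc n) * t ^ n) sums 0" if "t \<noteq> 0" for t
  proof -
    have "(\<lambda>n. a (Suc n) * t ^ Suc n) sums (0 - a 0 * t ^ 0)"
      using Suc(2)[OF that] by (subst sums_Suc_iff) (simp add: a0)
    then have "(\<lambda>n. (a (Suc n) * t ^ Suc n) / t) sums (0 / t)"
      by (intro sums_divide) (simp add: a0)
    then show ?thesis using that by simp
  qed
  then show ?case by (rule Suc.IH)
qed

text \<open>Separability stands in for coordinates: the complement of a closed ball is a countable
  union of half-spaces with normals in a dense set, and an open set is a countable union of closed
  balls.\<close>

lemma sets_borel_subset_of_halfspaces:
  fixes C :: "'h::{real_inner, second_countable_topology} set set"
  assumes C: "sigma_algebra UNIV C"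
    and half: "\<And>v c. {y. c < y \<bullet> v} \<in> C"
  shows "sets borel \<subseteq> C"
proof -
  interpret sigma_algebra UNIV C by fact
  obtain D :: "'h set" where D: "countable D" "\<And>X. open X \<Longrightarrow> X \<noteq> {} \<Longrightarrow> \<exists>d\<in>D. d \<in> X"
    by (rule countable_dense_setE) blast
  have dense: "\<exists>d\<in>D. dist d u < e" if "0 < e" for u e
    using D(2)[of "ball u e"] that by (auto simp: dist_commute)
  have outside: "{y. r < dist z y} \<in> C" if "0 \<le> r" for z r
  proof -
    \<comment> \<open>\<open>2 * (u \<bullet> d) - d \<bullet> d\<close> equals
      \<open>(norm u)\<^sup>2 - (norm (u - d))\<^sup>2\<close>, which never exceeds
      \<open>(norm u)\<^sup>2\<close> and comes arbitrarily close to it for \<open>d\<close> in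
      \<open>D\<close>.\<close>
    have iff: "r < norm u \<longleftrightarrow> (\<exists>d\<in>D. r\<^sup>2 + d \<bullet> d < 2 * (u \<bullet> d))" for u :: 'h
    proof
      assume "r < norm u"
      then have less: "r\<^sup>2 < (norm u)\<^sup>2" using that by (intro power_strict_mono) auto
      then obtain d where d: "d \<in> D" "dist d u < sqrt ((norm u)\<^sup>2 - r\<^sup>2)"
        using dense[of "sqrt ((norm u)\<^sup>2 - r\<^sup>2)"] by auto
      then have "(norm (d - u))\<^sup>2 < (norm u)\<^sup>2 - r\<^sup>2"
        using real_less_lsqrt less by (simp add: dist_norm real_less_rsqrt) (metis real_sqrt_less_iff real_sqrt_abs abs_norm_cancel)
      then have "r\<^sup>2 + d \<bullet> d < 2 * (u \<bullet> d)"
        by (simp add: power2_norm_eq_inner algebra_simps inner_commute)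
      with d(1) show "\<exists>d\<in>D. r\<^sup>2 + d \<bullet> d < 2 * (u \<bullet> d)" ..
    next
      assume "\<exists>d\<in>D. r\<^sup>2 + d \<bullet> d < 2 * (u \<bullet> d)"
      then obtain d where "r\<^sup>2 + d \<bullet> d < 2 * (u \<bullet> d)" ..
      moreover have "0 \<le> (norm (u - d))\<^sup>2" by simp
      ultimately have "r\<^sup>2 < (norm u)\<^sup>2"
        by (simp add: power2_norm_eq_inner algebra_simps inner_commute)
      then show "r < norm u" by (rule power_less_imp_less_base) simp
    qed
    have "{y. r < dist z y} = (\<Union>d\<in>D. {y. (r\<^sup>2 + d \<bullet> d) / 2 + z \<bullet> d < y \<bullet> d})"
    proof -
      have "r < dist z y \<longleftrightarrow> (\<exists>d\<in>D. (r\<^sup>2 + d \<bullet> d) / 2 + z \<bullet> d < y \<bullet> d)" for y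
        using iff[of "y - z"] by (simp add: dist_norm norm_minus_commute inner_diff_left field_simps)
      then show ?thesis by auto
    qed
    also have "\<dots> \<in> C" using D(1) half by (intro countable_UN'') auto
    finally show ?thesis .
  qed
  have cball: "cball z r \<in> C" if "0 \<le> r" for z r
  proof -
    have "UNIV - {y. r < dist z y} \<in> C" using outside[OF that] by (intro compl_sets)
    also have "UNIV - {y. r < dist z y} = cball z r" by (auto simp: cball_def)
    finally show ?thesis .
  qed
  have "U \<in> C" if "open U" for U
  proof -
    let ?I = "{(d, n :: nat). d \<in> D \<and> cball d (1 / real (Suc n)) \<subseteq> U}"
    have "U = (\<Union>(d, n)\<in>?I. cball d (1 / real (Suc n)))"
    proof (intro equalityI subsetI)
      fix u assume "u \<in> U"
      then obtain e where e: "0 < e" "ball u e \<subseteq> U" using \<open>open U\<close> open_contains_ball by blast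
      obtain n where n: "1 / real (Suc n) < e / 2" using e(1) nat_approx_posE[of "e / 2"] by auto
      obtain d where d: "d \<in> D" "dist d u < 1 / real (Suc n)" using dense[of "1 / real (Suc n)" u] by auto
      have "cball d (1 / real (Suc n)) \<subseteq> ball u e"
      proof
        fix w assume "w \<in> cball d (1 / real (Suc n))"
        then have "dist d w \<le> 1 / real (Suc n)" by simp
        then show "w \<in> ball u e"
          using d(2) n dist_triangle[of u w d] by (simp add: dist_commute)
      qed
      then have "(d, n) \<in> ?I" using d e by auto
      moreover have "u \<in> cball d (1 / real (Suc n))" using d by simp
      ultimately show "u \<in> (\<Union>(d, n)\<in>?I. cball d (1 / real (Suc n)))" by blast
    qed auto
    also have "\<dots> \<in> C"
    proof (rule countable_UN'')
      show "countable ?I"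
        using D(1) by (rule countable_subset[rotated, OF countable_SIGMA[of D "\<lambda>_. UNIV"]]) auto
    qed (auto intro!: cball)
    finally show ?thesis .
  qed
  then show ?thesis
    unfolding sets_borel using sigma_sets_subset[of "{S. open S}"] by auto
qed

section \<open>The Gaussian kernel\<close>

text \<open>The Parseval expansion in a family that is not normalised and may contain 0; the term of
  a zero vector is 0 because division by 0 is.\<close>

lemma inner_eq_sum_orthogonal:
  fixes u w :: "'h::real_inner"
  assumes C: "finite C" "pairwise orthogonal C" and u: "u \<in> span C"
  shows "u \<bullet> w = (\<Sum>e\<in>C. (e \<bullet> u) * (e \<bullet> w) / (e \<bullet> e))"
  using u
proof (induction rule: span_induct_alt)
  case (step c x y)
  have "(\<Sum>e\<in>C. (e \<bullet> x) * (e \<bullet> w) / (e \<bullet> e)) = (\<Sum>e\<in>C. if e = x then x \<bullet> w else 0)"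
  proof (rule sum.cong)
    fix e assume e: "e \<in> C"
    show "(e \<bullet> x) * (e \<bullet> w) / (e \<bullet> e) = (if e = x then x \<bullet> w else 0)"
    proof (cases "e = x")
      case False
      then have "e \<bullet> x = 0" using C(2) e step(1) by (auto simp: pairwise_def orthogonal_def)
      then show ?thesis using False by simp
    qed (cases "x = 0"; simp)
  qed simp
  then have "x \<bullet> w = (\<Sum>e\<in>C. (e \<bullet> x) * (e \<bullet> w) / (e \<bullet> e))" using C(1) step(1) by simp
  with step(2) show ?case
    by (simp add: inner_add_left inner_add_right distrib_right add_divide_distrib sum.distrib
        sum_distrib_left mult.assoc)
qed simp

text \<open>The Schur product theorem for powers of a Gram matrix: expand one factor in an
  orthogonal family spanning the points, absorb \<open>e \<bullet> y i\<close> into the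
  coefficients, and induct with arbitrary coefficients.\<close>

lemma inner_power_sum_nonneg:
  fixes y :: "'i \<Rightarrow> 'h::real_inner"
  assumes I: "finite I"
  shows "0 \<le> (\<Sum>i\<in>I. \<Sum>j\<in>I. c i * c j * (y i \<bullet> y j) ^ k)"
proof -
  obtain C where C: "finite C" "span C = span (y ` I)" "pairwise orthogonal C"
    using basis_orthogonal[of "y ` I"] I by auto
  have y: "y i \<bullet> y j = (\<Sum>e\<in>C. (e \<bullet> y i) * (e \<bullet> y j) / (e \<bullet> e))" if "i \<in> I" for i j
    using that by (intro inner_eq_sum_orthogonal C) (simp add: C(2) span_base)
  show ?thesis
  proof (induction k arbitrary: c)
    case 0
    have "(\<Sum>i\<in>I. \<Sum>j\<in>I. c i * c j) = (\<Sum>i\<in>I. c i) * (\<Sum>j\<in>I. c j)" by (simp add: sum_product)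
    then show ?case by simp
  next
    case (Suc k)
    have "(\<Sum>i\<in>I. \<Sum>j\<in>I. c i * c j * (y i \<bullet> y j) ^ Suc k)
        = (\<Sum>i\<in>I. \<Sum>j\<in>I. \<Sum>e\<in>C. c i * c j * (y i \<bullet> y j) ^ k * ((e \<bullet> y i) * (e \<bullet> y j) / (e \<bullet> e)))"
    proof (intro sum.cong refl)
      fix i j assume "i \<in> I"
      have "(\<Sum>e\<in>C. c i * c j * (y i \<bullet> y j) ^ k * ((e \<bullet> y i) * (e \<bullet> y j) / (e \<bullet> e)))
          = c i * c j * (y i \<bullet> y j) ^ k * (y i \<bullet> y j)"
        by (simp only: y[OF \<open>i \<in> I\<close>, symmetric] sum_distrib_left[symmetric])
      then show "c i * c j * (y i \<bullet> y j) ^ Suc k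
          = (\<Sum>e\<in>C. c i * c j * (y i \<bullet> y j) ^ k * ((e \<bullet> y i) * (e \<bullet> y j) / (e \<bullet> e)))"
        by (simp only: power_Suc mult_ac)
    qed
    also have "\<dots> = (\<Sum>i\<in>I. \<Sum>e\<in>C. \<Sum>j\<in>I. c i * c j * (y i \<bullet> y j) ^ k * ((e \<bullet> y i) * (e \<bullet> y j) / (e \<bullet> e)))"
      by (intro sum.cong refl sum.swap)
    also have "\<dots> = (\<Sum>e\<in>C. \<Sum>i\<in>I. \<Sum>j\<in>I. c i * c j * (y i \<bullet> y j) ^ k * ((e \<bullet> y i) * (e \<bullet> y j) / (e \<bullet> e)))"
      by (rule sum.swap)
    also have "\<dots> = (\<Sum>e\<in>C. (\<Sum>i\<in>I. \<Sum>j\<in>I. (c i * (e \<bullet> y i)) * (c j * (e \<bullet> y j)) * (y i \<bullet> y j) ^ k) / (e \<bullet> e))"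
      by (simp add: sum_divide_distrib mult_ac)
    also have "0 \<le> \<dots>"
      by (rule sum_nonneg, rule divide_nonneg_nonneg, rule Suc.IH) simp
    finally show ?case .
  qed
qed

lemma gaussian_kernel_eq:
  fixes y z :: "'h::real_inner"
  shows "gaussian_kernel \<sigma> y z =
    exp (- (norm y)\<^sup>2 / \<sigma>\<^sup>2) * exp (- (norm z)\<^sup>2 / \<sigma>\<^sup>2) * exp (y \<bullet> ((2 / \<sigma>\<^sup>2) *\<^sub>R z))"
  unfolding gaussian_kernel_def
  by (simp add: power2_norm_eq_inner inner_diff_left inner_diff_right inner_commute add_divide_distrib
      diff_divide_distrib flip: exp_add)

text \<open>The one-variable factors of \<open>gaussian_kernel_eq\<close> go into the coefficients;
  what remains is an exponential of inner products, a power series with nonnegative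
  coefficients.\<close>

lemma gaussian_kernel_sum_nonneg:
  fixes y :: "'i \<Rightarrow> 'h::real_inner"
  assumes I: "finite I"
  shows "0 \<le> (\<Sum>i\<in>I. \<Sum>j\<in>I. c i * c j * gaussian_kernel \<sigma> (y i) (y j))"
proof -
  define b where "b i = c i * exp (- (norm (y i))\<^sup>2 / \<sigma>\<^sup>2)" for i
  define s where "s = 2 / \<sigma>\<^sup>2"
  have s: "0 \<le> s" by (simp add: s_def)
  have series: "(\<lambda>k. s ^ k / fact k * (\<Sum>i\<in>I. \<Sum>j\<in>I. b i * b j * (y i \<bullet> y j) ^ k))
      sums (\<Sum>i\<in>I. \<Sum>j\<in>I. b i * b j * exp (s * (y i \<bullet> y j)))"
  proof -
    have "(\<lambda>k. \<Sum>i\<in>I. \<Sum>j\<in>I. b i * b j * ((s * (y i \<bullet> y j)) ^ k /\<^sub>R fact k))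
        sums (\<Sum>i\<in>I. \<Sum>j\<in>I. b i * b j * exp (s * (y i \<bullet> y j)))"
      by (intro sums_sum sums_mult exp_converges)
    moreover have "(\<Sum>i\<in>I. \<Sum>j\<in>I. b i * b j * ((s * (y i \<bullet> y j)) ^ k /\<^sub>R fact k))
        = s ^ k / fact k * (\<Sum>i\<in>I. \<Sum>j\<in>I. b i * b j * (y i \<bullet> y j) ^ k)" for k
      by (simp add: sum_distrib_left power_mult_distrib field_simps)
    ultimately show ?thesis by simp
  qed
  have "0 \<le> s ^ k / fact k * (\<Sum>i\<in>I. \<Sum>j\<in>I. b i * b j * (y i \<bullet> y j) ^ k)" for k
    by (rule mult_nonneg_nonneg[OF _ inner_power_sum_nonneg[OF I]]) (use s in simp)
  from sums_le[OF this sums_zero series]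
  have "0 \<le> (\<Sum>i\<in>I. \<Sum>j\<in>I. b i * b j * exp (s * (y i \<bullet> y j)))" .
  also have "\<dots> = (\<Sum>i\<in>I. \<Sum>j\<in>I. c i * c j * gaussian_kernel \<sigma> (y i) (y j))"
    by (simp add: gaussian_kernel_eq b_def s_def mult_ac)
  finally show ?thesis .
qed

lemma gaussian_kernel_commute: "gaussian_kernel \<sigma> y z = gaussian_kernel \<sigma> z y"
  by (simp add: gaussian_kernel_def norm_minus_commute)

lemma abs_gaussian_kernel_le_1: "\<bar>gaussian_kernel \<sigma> y z\<bar> \<le> 1"
  by (simp add: gaussian_kernel_def)

lemma gaussian_kernel_measurable [measurable (raw)]:
  fixes f g :: "'a \<Rightarrow> 'h::{real_inner, second_countable_topology}"
  assumes [measurable]: "f \<in> borel_measurable M" "g \<in> borel_measurable M"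
  shows "(\<lambda>x. gaussian_kernel \<sigma> (f x) (g x)) \<in> borel_measurable M"
  unfolding gaussian_kernel_def by measurable

lemma pd_kernel_gaussian:
  "pd_kernel borel (gaussian_kernel \<sigma> :: 'h::{real_inner, second_countable_topology} \<Rightarrow> 'h \<Rightarrow> real)"
  unfolding pd_kernel_def
  by (auto intro: gaussian_kernel_sum_nonneg gaussian_kernel_commute)

text \<open>The map \<open>f\<close> is the identity for the kernel itself and a simple function for
  its discretisations.\<close>

lemma gaussian_kernel_integrable:
  fixes \<mu> \<nu> :: "'h::{real_inner, second_countable_topology} measure" and f :: "'h \<Rightarrow> 'h"
  assumes "finite_measure \<mu>" "finite_measure \<nu>" "sets \<mu> = sets borel" "sets \<nu> = sets borel"
    and f: "f \<in> borel_measurable borel"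
  shows "integrable (\<mu> \<Otimes>\<^sub>M \<nu>) (\<lambda>z. gaussian_kernel \<sigma> (f (fst z)) (f (snd z)))"
proof (rule finite_measure.integrable_const_bound)
  show "finite_measure (\<mu> \<Otimes>\<^sub>M \<nu>)" using assms by (intro finite_measure_pair_measure)
  show "AE z in \<mu> \<Otimes>\<^sub>M \<nu>. norm (gaussian_kernel \<sigma> (f (fst z)) (f (snd z))) \<le> 1"
    by (simp add: abs_gaussian_kernel_le_1)
  have [measurable]: "f \<in> borel_measurable \<mu>" "f \<in> borel_measurable \<nu>"
    using assms by (simp_all cong: measurable_cong_sets)
  show "(\<lambda>z. gaussian_kernel \<sigma> (f (fst z)) (f (snd z))) \<in> borel_measurable (\<mu> \<Otimes>\<^sub>M \<nu>)"
    by measurable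
qed

lemma integral_compose_finite_range:
  fixes h :: "'b \<Rightarrow> real"
  assumes fin: "finite_measure \<mu>" and F: "simple_function \<mu> F" and S: "finite S" "F ` space \<mu> \<subseteq> S"
  shows "(\<integral>y. h (F y) \<partial>\<mu>) = (\<Sum>u\<in>S. measure \<mu> (F -` {u} \<inter> space \<mu>) * h u)"
proof -
  interpret finite_measure \<mu> by fact
  have sets: "F -` {u} \<inter> space \<mu> \<in> sets \<mu>" for u using F by (rule simple_functionD(2))
  have "(\<integral>y. h (F y) \<partial>\<mu>) = (\<integral>y. (\<Sum>u\<in>S. indicator (F -` {u} \<inter> space \<mu>) y * h u) \<partial>\<mu>)"
  proof (rule Bochner_Integration.integral_cong)
    fix y assume y: "y \<in> space \<mu>"
    have "(\<Sum>u\<in>S. indicator (F -` {u} \<inter> space \<mu>) y * h u) = (\<Sum>u\<in>S. if u = F y then h u else 0)"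
      using y by (intro sum.cong) (auto simp: indicator_def)
    then show "h (F y) = (\<Sum>u\<in>S. indicator (F -` {u} \<inter> space \<mu>) y * h u)" using S y by auto
  qed simp
  also have "\<dots> = (\<Sum>u\<in>S. \<integral>y. indicator (F -` {u} \<inter> space \<mu>) y * h u \<partial>\<mu>)"
    using sets by (intro Bochner_Integration.integral_sum integrable_mult_left integrable_real_indicator)
      (auto simp: less_top[symmetric])
  also have "\<dots> = (\<Sum>u\<in>S. measure \<mu> (F -` {u} \<inter> space \<mu>) * h u)"
    using sets by (simp add: Int_absorb2 sets.sets_into_space)
  finally show ?thesis .
qed

text \<open>Positive definiteness at finitely many points passes to signed measures by discretising
  the identity; the point mass \<open>t \<cdot> \<delta>\<^sub>z\<close> is included for the Cauchy-Schwarz argument.\<close>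

lemma gaussian_kernel_integral_nonneg:
  fixes \<mu> \<nu> :: "'h::{real_inner, second_countable_topology} measure" and z :: 'h and \<sigma> t :: real
  defines "k \<equiv> kernel_integral (gaussian_kernel \<sigma>)"
  assumes fin: "finite_measure \<mu>" "finite_measure \<nu>"
    and sets: "sets \<mu> = sets borel" "sets \<nu> = sets borel"
  shows "0 \<le> k \<mu> \<mu> - k \<mu> \<nu> - k \<nu> \<mu> + k \<nu> \<nu>
    + 2 * t * ((\<integral>y. gaussian_kernel \<sigma> y z \<partial>\<mu>) - (\<integral>y. gaussian_kernel \<sigma> y z \<partial>\<nu>)) + t\<^sup>2"
proof -
  let ?K = "gaussian_kernel \<sigma> :: 'h \<Rightarrow> 'h \<Rightarrow> real"
  \<comment> \<open>Second countability makes the identity a pointwise limit of simple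
    functions.\<close>
  obtain F :: "nat \<Rightarrow> 'h \<Rightarrow> 'h" where F: "\<And>n. simple_function borel (F n)"
    "\<And>y. (\<lambda>n. F n y) \<longlonglongrightarrow> y"
    using borel_measurable_implies_sequence_metric[of "\<lambda>y. y" borel 0] by auto
  have F_borel: "F n \<in> borel_measurable borel" for n
    using F(1) by (rule borel_measurable_simple_function)
  define kF where "kF n \<alpha> \<beta> = (\<integral>p. ?K (F n (fst p)) (F n (snd p)) \<partial>(\<alpha> \<Otimes>\<^sub>M \<beta>))" for n \<alpha> \<beta>
  define pF where "pF n \<alpha> = (\<integral>y. ?K (F n y) z \<partial>\<alpha>)" for n \<alpha>
  have K_lim: "(\<lambda>n. ?K (f n) (g n)) \<longlonglongrightarrow> ?K a b" if "f \<longlonglongrightarrow> a" "g \<longlonglongrightarrow> b" for f g a b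
    unfolding gaussian_kernel_def divide_inverse using that by (intro tendsto_intros)
  have kF_lim: "(\<lambda>n. kF n \<alpha> \<beta>) \<longlonglongrightarrow> k \<alpha> \<beta>"
    if "finite_measure \<alpha>" "finite_measure \<beta>" "sets \<alpha> = sets borel" "sets \<beta> = sets borel" for \<alpha> \<beta>
    unfolding kF_def k_def kernel_integral_def
  proof (rule integral_dominated_convergence[where w = "\<lambda>_. 1"])
    show "(\<lambda>p. ?K (fst p) (snd p)) \<in> borel_measurable (\<alpha> \<Otimes>\<^sub>M \<beta>)"
      using gaussian_kernel_integrable[OF that, of "\<lambda>y. y" \<sigma>] by auto
    show "(\<lambda>p. ?K (F n (fst p)) (F n (snd p))) \<in> borel_measurable (\<alpha> \<Otimes>\<^sub>M \<beta>)" for n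
      using gaussian_kernel_integrable[OF that F_borel] by auto
    interpret finite_measure "\<alpha> \<Otimes>\<^sub>M \<beta>" using that by (intro finite_measure_pair_measure)
    show "integrable (\<alpha> \<Otimes>\<^sub>M \<beta>) (\<lambda>_. 1 :: real)" by simp
  qed (auto intro!: AE_I2 K_lim F(2) simp: abs_gaussian_kernel_le_1)
  have pF_lim: "(\<lambda>n. pF n \<alpha>) \<longlonglongrightarrow> (\<integral>y. ?K y z \<partial>\<alpha>)"
    if "finite_measure \<alpha>" "sets \<alpha> = sets borel" for \<alpha>
    unfolding pF_def
  proof (rule integral_dominated_convergence[where w = "\<lambda>_. 1"])
    have [measurable]: "F n \<in> borel_measurable \<alpha>" "(\<lambda>y. y) \<in> borel_measurable \<alpha>" for n
      using F_borel that by (simp_all cong: measurable_cong_sets)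
    show "(\<lambda>y. ?K y z) \<in> borel_measurable \<alpha>" "(\<lambda>y. ?K (F n y) z) \<in> borel_measurable \<alpha>" for n
      by measurable
    interpret finite_measure \<alpha> by fact
    show "integrable \<alpha> (\<lambda>_. 1 :: real)" by simp
  qed (auto intro!: AE_I2 K_lim F(2) simp: abs_gaussian_kernel_le_1)
  have nonneg: "0 \<le> kF n \<mu> \<mu> - kF n \<mu> \<nu> - kF n \<nu> \<mu> + kF n \<nu> \<nu> + 2 * t * (pF n \<mu> - pF n \<nu>) + t\<^sup>2" for n
  proof -
    \<comment> \<open>Adding \<open>z\<close> to the nodes lets the point mass enter the same finite
      sum.\<close>
    define S where "S = insert z (range (F n))"
    have S: "finite S" using F(1)[of n] by (simp add: S_def simple_function_def)
    define w where "w \<alpha> u = measure \<alpha> (F n -` {u} \<inter> space \<alpha>)" for \<alpha> u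
    have int: "(\<integral>y. h (F n y) \<partial>\<alpha>) = (\<Sum>u\<in>S. w \<alpha> u * h u)"
      if "finite_measure \<alpha>" "sets \<alpha> = sets borel" for \<alpha> and h :: "'h \<Rightarrow> real"
      unfolding w_def
    proof (rule integral_compose_finite_range[OF that(1) _ S])
      show "simple_function \<alpha> (F n)"
        using F(1)[of n] that(2) sets_eq_imp_space_eq[OF that(2)] by (simp add: simple_function_def)
    qed (auto simp: S_def)
    have kF: "kF n \<alpha> \<beta> = (\<Sum>u\<in>S. \<Sum>v\<in>S. w \<alpha> u * w \<beta> v * ?K u v)"
      if "finite_measure \<alpha>" "finite_measure \<beta>" "sets \<alpha> = sets borel" "sets \<beta> = sets borel" for \<alpha> \<beta>
    proof -
      interpret \<alpha>: finite_measure \<alpha> by fact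
      interpret \<beta>: finite_measure \<beta> by fact
      interpret pair_sigma_finite \<alpha> \<beta> ..
      have "kF n \<alpha> \<beta> = (\<integral>y. (\<integral>y'. ?K (F n y) (F n y') \<partial>\<beta>) \<partial>\<alpha>)"
        unfolding kF_def using integral_fst'[OF gaussian_kernel_integrable[OF that F_borel]] by simp
      also have "\<dots> = (\<Sum>u\<in>S. w \<alpha> u * (\<Sum>v\<in>S. w \<beta> v * ?K u v))"
        by (simp only: int[OF that(2,4)] int[OF that(1,3), of "\<lambda>u. \<Sum>v\<in>S. w \<beta> v * ?K u v"])
      finally show ?thesis by (simp add: sum_distrib_left mult.assoc)
    qed
    have pF: "pF n \<alpha> = (\<Sum>u\<in>S. w \<alpha> u * ?K u z)"
      if "finite_measure \<alpha>" "sets \<alpha> = sets borel" for \<alpha>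
      unfolding pF_def by (rule int[OF that])
    define c where "c u = w \<mu> u - w \<nu> u" for u
    have "0 \<le> (\<Sum>u\<in>S. \<Sum>v\<in>S. (c u + (if u = z then t else 0)) * (c v + (if v = z then t else 0)) * ?K u v)"
      by (rule gaussian_kernel_sum_nonneg[OF S, where y = "\<lambda>u. u"])
    also have "\<dots> = (\<Sum>u\<in>S. \<Sum>v\<in>S. c u * c v * ?K u v) + (\<Sum>u\<in>S. c u * t * ?K u z)
        + (\<Sum>v\<in>S. t * c v * ?K z v) + t * t * ?K z z"
    proof -
      have "(c u + (if u = z then t else 0)) * (c v + (if v = z then t else 0)) * ?K u v
          = c u * c v * ?K u v + (if v = z then c u * t * ?K u z else 0)
            + (if u = z then t * c v * ?K z v else 0) + (if u = z then if v = z then t * t * ?K z z else 0 else 0)" for u v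
        by (cases "u = z"; cases "v = z") (simp_all add: algebra_simps)
      moreover have "z \<in> S" by (simp add: S_def)
      moreover have "(\<Sum>v\<in>S. if u = z then f v else 0) = (if u = z then \<Sum>v\<in>S. f v else 0)" for u and f :: "'h \<Rightarrow> real"
        by simp
      ultimately show ?thesis using S by (simp add: sum.distrib)
    qed
    also have "(\<Sum>u\<in>S. \<Sum>v\<in>S. c u * c v * ?K u v) = kF n \<mu> \<mu> - kF n \<mu> \<nu> - kF n \<nu> \<mu> + kF n \<nu> \<nu>"
      by (simp add: kF fin sets c_def algebra_simps sum.distrib sum_subtractf)
    also have "(\<Sum>u\<in>S. c u * t * ?K u z) = t * (pF n \<mu> - pF n \<nu>)"
      by (simp add: pF fin sets c_def algebra_simps sum_subtractf sum_distrib_left)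
    also have "(\<Sum>v\<in>S. t * c v * ?K z v) = t * (pF n \<mu> - pF n \<nu>)"
      by (simp add: pF fin sets c_def algebra_simps sum_subtractf sum_distrib_left gaussian_kernel_commute[of _ z])
    also have "?K z z = 1" by (simp add: gaussian_kernel_def)
    finally show ?thesis by (simp add: power2_eq_square algebra_simps)
  qed
  show ?thesis
    by (rule LIMSEQ_le_const[where X = "\<lambda>n. kF n \<mu> \<mu> - kF n \<mu> \<nu> - kF n \<nu> \<mu> + kF n \<nu> \<nu> + 2 * t * (pF n \<mu> - pF n \<nu>) + t\<^sup>2"])
      (auto intro!: tendsto_intros kF_lim pF_lim fin sets simp: nonneg)
qed

section \<open>Gaussian-weighted power series and recovery of the measure\<close>

definition gaussian_weight :: "real \<Rightarrow> 'h::real_normed_vector \<Rightarrow> real" where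
  "gaussian_weight \<sigma> y = exp (- (norm y)\<^sup>2 / \<sigma>\<^sup>2)"

text \<open>With \<open>a = norm y / \<sigma>\<close> and \<open>b = \<sigma> * norm v\<close> the
  exponent is at most \<open>a * b - a\<^sup>2\<close>, and
  \<open>2 * a * b \<le> a\<^sup>2 + b\<^sup>2\<close>. The bound is uniform in \<open>y\<close>,
  hence integrable for every finite measure.\<close>

lemma gaussian_weight_exp_le:
  fixes y v :: "'h::real_inner"
  assumes \<sigma>: "0 < \<sigma>"
  shows "gaussian_weight \<sigma> y * exp \<bar>y \<bullet> v\<bar> \<le> exp ((\<sigma> * norm v)\<^sup>2)"
proof -
  have "- (norm y)\<^sup>2 / \<sigma>\<^sup>2 + \<bar>y \<bullet> v\<bar> \<le> - (norm y)\<^sup>2 / \<sigma>\<^sup>2 + norm y * norm v"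
    using Cauchy_Schwarz_ineq2[of y v] by simp
  also have "\<dots> = - (norm y / \<sigma>)\<^sup>2 + (norm y / \<sigma>) * (\<sigma> * norm v)"
    using \<sigma> by (simp add: power_divide)
  also have "\<dots> \<le> (\<sigma> * norm v)\<^sup>2"
    using sum_squares_bound[of "norm y / \<sigma>" "\<sigma> * norm v"] zero_le_power2[of "norm y / \<sigma>"]
      zero_le_power2[of "\<sigma> * norm v"] by linarith
  finally show ?thesis by (simp add: gaussian_weight_def flip: exp_add)
qed

text \<open>One interchange of sum and integral that serves exp, cos and sin: coefficients bounded
  by those of exp keep all absolute partial sums below the constant of
  \<open>gaussian_weight_exp_le\<close>.\<close>

lemma gaussian_weight_power_series_sums:
  fixes \<mu> :: "'h::{real_inner, second_countable_topology} measure" and a :: "nat \<Rightarrow> real"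
  assumes \<sigma>: "0 < \<sigma>" and fin: "finite_measure \<mu>" and sets: "sets \<mu> = sets borel"
    and a: "\<And>k. \<bar>a k\<bar> \<le> 1 / fact k"
  shows "(\<lambda>k. a k * (\<integral>y. gaussian_weight \<sigma> y * (y \<bullet> v) ^ k \<partial>\<mu>))
    sums (\<integral>y. gaussian_weight \<sigma> y * (\<Sum>k. a k * (y \<bullet> v) ^ k) \<partial>\<mu>)"
proof -
  interpret finite_measure \<mu> by fact
  let ?C = "exp ((\<sigma> * norm v)\<^sup>2)"
  have id[measurable]: "(\<lambda>y. y) \<in> borel_measurable \<mu>" using sets by (simp cong: measurable_cong_sets)
  have [measurable]: "gaussian_weight \<sigma> \<in> borel_measurable \<mu>"
    unfolding gaussian_weight_def by measurable
  define f where "f k y = gaussian_weight \<sigma> y * (a k * (y \<bullet> v) ^ k)" for k y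
  have w0: "0 < gaussian_weight \<sigma> y" for y :: 'h by (simp add: gaussian_weight_def)
  have exp_sums: "(\<lambda>k. \<bar>y \<bullet> v\<bar> ^ k / fact k) sums exp \<bar>y \<bullet> v\<bar>" for y
    using exp_converges[of "\<bar>y \<bullet> v\<bar>"] by (simp add: divide_inverse mult.commute)
  have term_le: "\<bar>a k * (y \<bullet> v) ^ k\<bar> \<le> \<bar>y \<bullet> v\<bar> ^ k / fact k" for k y
    using mult_right_mono[OF a[of k], of "\<bar>y \<bullet> v\<bar> ^ k"] by (simp add: abs_mult power_abs)
  have partial: "(\<Sum>k<n. \<bar>f k y\<bar>) \<le> ?C" for n y
  proof -
    have "(\<Sum>k<n. \<bar>f k y\<bar>) = gaussian_weight \<sigma> y * (\<Sum>k<n. \<bar>a k * (y \<bullet> v) ^ k\<bar>)"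
      using w0[of y] by (simp add: f_def sum_distrib_left abs_mult)
    also have "\<dots> \<le> gaussian_weight \<sigma> y * (\<Sum>k<n. \<bar>y \<bullet> v\<bar> ^ k / fact k)"
      using w0[of y] term_le by (intro mult_left_mono sum_mono) auto
    also have "\<dots> \<le> gaussian_weight \<sigma> y * exp \<bar>y \<bullet> v\<bar>"
    proof (rule mult_left_mono)
      have "(\<Sum>k<n. \<bar>y \<bullet> v\<bar> ^ k / fact k) \<le> (\<Sum>k. \<bar>y \<bullet> v\<bar> ^ k / fact k)"
        using exp_sums[of y] by (intro sum_le_suminf) (auto simp: sums_iff)
      then show "(\<Sum>k<n. \<bar>y \<bullet> v\<bar> ^ k / fact k) \<le> exp \<bar>y \<bullet> v\<bar>"
        using exp_sums[of y] by (simp only: sums_iff)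
    qed (use w0[of y] in simp)
    also have "\<dots> \<le> ?C" using \<sigma> by (rule gaussian_weight_exp_le)
    finally show ?thesis .
  qed
  have le_C: "\<bar>f k y\<bar> \<le> ?C" for k y
    by (rule order_trans[OF member_le_sum[of k "{..<Suc k}" "\<lambda>k. \<bar>f k y\<bar>"] partial]) auto
  have f_int: "integrable \<mu> (f k)" for k
  proof (rule integrable_const_bound[of _ ?C])
    show "AE y in \<mu>. norm (f k y) \<le> ?C" using le_C by simp
    show "f k \<in> borel_measurable \<mu>" unfolding f_def by measurable
  qed
  have "(\<lambda>k. \<integral>y. f k y \<partial>\<mu>) sums (\<integral>y. (\<Sum>k. f k y) \<partial>\<mu>)"
  proof (rule sums_integral[OF f_int])
    show "AE y in \<mu>. summable (\<lambda>k. norm (f k y))"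
      using partial by (intro AE_I2 summableI_nonneg_bounded) auto
    show "summable (\<lambda>k. \<integral>y. norm (f k y) \<partial>\<mu>)"
    proof (rule summableI_nonneg_bounded)
      fix n
      have "(\<Sum>k<n. \<integral>y. norm (f k y) \<partial>\<mu>) = (\<integral>y. (\<Sum>k<n. \<bar>f k y\<bar>) \<partial>\<mu>)"
        using f_int by (simp add: Bochner_Integration.integral_sum)
      also have "\<dots> \<le> (\<integral>y. ?C \<partial>\<mu>)"
        using f_int partial by (intro integral_mono) auto
      finally show "(\<Sum>k<n. \<integral>y. norm (f k y) \<partial>\<mu>) \<le> (\<integral>y. ?C \<partial>\<mu>)" .
    qed simp
  qed
  moreover have "(\<integral>y. f k y \<partial>\<mu>) = a k * (\<integral>y. gaussian_weight \<sigma> y * (y \<bullet> v) ^ k \<partial>\<mu>)" for k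
    unfolding f_def by (subst mult.left_commute) simp
  moreover have "(\<Sum>k. f k y) = gaussian_weight \<sigma> y * (\<Sum>k. a k * (y \<bullet> v) ^ k)" for y
    unfolding f_def
  proof (rule suminf_mult)
    show "summable (\<lambda>k. a k * (y \<bullet> v) ^ k)"
    proof (rule summable_comparison_test'[where N = 0])
      show "summable (\<lambda>k. \<bar>y \<bullet> v\<bar> ^ k / fact k)" using exp_sums[of y] by (rule sums_summable)
      show "norm (a k * (y \<bullet> v) ^ k) \<le> \<bar>y \<bullet> v\<bar> ^ k / fact k" for k
        using term_le by (simp only: real_norm_def)
    qed
  qed
  ultimately show ?thesis by simp
qed

lemma measure_eq_of_gaussian_potential_eq:
  fixes \<mu> \<nu> :: "'h::{real_inner, second_countable_topology} measure"
  assumes \<sigma>: "0 < \<sigma>" and fin: "finite_measure \<mu>" "finite_measure \<nu>"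
    and sets: "sets \<mu> = sets borel" "sets \<nu> = sets borel"
    and eq: "\<And>z. (\<integral>y. gaussian_kernel \<sigma> y z \<partial>\<mu>) = (\<integral>y. gaussian_kernel \<sigma> y z \<partial>\<nu>)"
  shows "\<mu> = \<nu>"
proof -
  let ?w = "gaussian_weight \<sigma> :: 'h \<Rightarrow> real"
  have w0: "0 < ?w y" and w1: "?w y \<le> 1" for y by (simp_all add: gaussian_weight_def)
  have w_meas[measurable]: "?w \<in> borel_measurable borel" unfolding gaussian_weight_def by measurable
  have laplace: "(\<integral>y. ?w y * exp (y \<bullet> u) \<partial>\<mu>) = (\<integral>y. ?w y * exp (y \<bullet> u) \<partial>\<nu>)" for u
  proof -
    \<comment> \<open>Chosen so that the linear exponent in \<open>gaussian_kernel_eq\<close> is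
      \<open>y \<bullet> u\<close>; the positive factor \<open>?w z\<close> cancels.\<close>
    define z where "z = (\<sigma>\<^sup>2 / 2) *\<^sub>R u"
    have "gaussian_kernel \<sigma> y z = ?w z * (?w y * exp (y \<bullet> u))" for y
      using \<sigma> by (simp add: gaussian_kernel_eq gaussian_weight_def z_def)
    then show ?thesis using eq[of z] w0[of z] by simp
  qed
  define m where "m \<kappa> v k = (\<integral>y. ?w y * (y \<bullet> v) ^ k \<partial>\<kappa>)" for \<kappa> v and k :: nat
  have series: "(\<lambda>k. a k * m \<kappa> v k) sums (\<integral>y. ?w y * (\<Sum>k. a k * (y \<bullet> v) ^ k) \<partial>\<kappa>)"
    if "finite_measure \<kappa>" "sets \<kappa> = sets borel" "\<And>k. \<bar>a k\<bar> \<le> 1 / fact k" for \<kappa> v a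
    unfolding m_def using \<sigma> that by (rule gaussian_weight_power_series_sums)
  have moments: "m \<mu> v k = m \<nu> v k" for v k
  proof -
    have exp_series: "(\<lambda>k. 1 / fact k * m \<kappa> u k) sums (\<integral>y. ?w y * exp (y \<bullet> u) \<partial>\<kappa>)"
      if "finite_measure \<kappa>" "sets \<kappa> = sets borel" for \<kappa> u
    proof -
      have "(\<Sum>k. 1 / fact k * (y \<bullet> u) ^ k) = exp (y \<bullet> u)" for y
        using exp_converges[of "y \<bullet> u"] by (simp add: sums_iff divide_inverse)
      then show ?thesis using series[OF that, of "\<lambda>k. 1 / fact k" u] by simp
    qed
    \<comment> \<open>Along the line through \<open>v\<close>, equality of the Laplace transforms
      says that a power series in \<open>t\<close> vanishes identically.\<close>
    have "(\<lambda>k. (m \<mu> v k - m \<nu> v k) / fact k * t ^ k) sums 0" for t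
    proof -
      have "?w y * (y \<bullet> (t *\<^sub>R v)) ^ k = t ^ k * (?w y * (y \<bullet> v) ^ k)" for y k
        by (simp add: power_mult_distrib)
      then have "m \<kappa> (t *\<^sub>R v) k = t ^ k * m \<kappa> v k" for \<kappa> k
        by (simp only: m_def integral_mult_right_zero)
      then show ?thesis
        using sums_diff[OF exp_series[OF fin(1) sets(1), of "t *\<^sub>R v"] exp_series[OF fin(2) sets(2), of "t *\<^sub>R v"]]
        by (simp only: laplace) (simp add: algebra_simps diff_divide_distrib)
    qed
    then have "(m \<mu> v k - m \<nu> v k) / fact k = 0" by (rule powser_zero_imp_coeff_zero)
    then show ?thesis by simp
  qed
  define F :: "('h \<Rightarrow> real) set" where "F = range (\<lambda>v y. cos (y \<bullet> v)) \<union> range (\<lambda>v y. sin (y \<bullet> v))"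
  have trig: "(\<integral>y. ?w y * f y \<partial>\<mu>) = (\<integral>y. ?w y * f y \<partial>\<nu>)" if "f \<in> F" for f
  proof -
    have *: "(\<integral>y. ?w y * (\<Sum>k. a k * (y \<bullet> v) ^ k) \<partial>\<mu>) = (\<integral>y. ?w y * (\<Sum>k. a k * (y \<bullet> v) ^ k) \<partial>\<nu>)"
      if "\<And>k. \<bar>a k\<bar> \<le> 1 / fact k" for a v
      using series[OF fin(1) sets(1) that, of v] series[OF fin(2) sets(2) that, of v]
      unfolding moments by (rule sums_unique2)
    have "\<bar>cos_coeff k\<bar> \<le> 1 / fact k" "\<bar>sin_coeff k\<bar> \<le> 1 / fact k" for k
      by (simp_all add: cos_coeff_def sin_coeff_def)
    moreover have "(\<Sum>k. cos_coeff k * x ^ k) = cos x" "(\<Sum>k. sin_coeff k * x ^ k) = sin x" for x :: real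
      using cos_converges[of x] sin_converges[of x] by (simp_all add: sums_iff)
    ultimately show ?thesis
      using that *[of cos_coeff] *[of sin_coeff] by (auto simp: F_def)
  qed
  interpret F: multiplicative_family F
  proof
    have "cos (y \<bullet> 0) = 1" for y :: 'h by simp
    then show "(\<lambda>_. 1) \<in> F" unfolding F_def by (intro UnI1 range_eqI[of _ _ 0]) simp
    show "\<exists>B. \<forall>x. \<bar>f x\<bar> \<le> B" if "f \<in> F" for f
      using that by (intro exI[of _ 1]) (auto simp: F_def)
    have cos_in: "(\<lambda>y. c * cos (y \<bullet> v)) \<in> bounded_class F"
      and sin_in: "(\<lambda>y. c * sin (y \<bullet> v)) \<in> bounded_class F" for c v
      by (rule bounded_class.scale[OF bounded_class.base], simp add: F_def)+
    have cc: "cos (y \<bullet> v) * cos (y \<bullet> u) = 1/2 * cos (y \<bullet> (v - u)) + 1/2 * cos (y \<bullet> (v + u))"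
      and ss: "sin (y \<bullet> v) * sin (y \<bullet> u) = 1/2 * cos (y \<bullet> (v - u)) + (-1/2) * cos (y \<bullet> (v + u))"
      and sc: "sin (y \<bullet> v) * cos (y \<bullet> u) = 1/2 * sin (y \<bullet> (v + u)) + 1/2 * sin (y \<bullet> (v - u))"
      and cs: "cos (y \<bullet> v) * sin (y \<bullet> u) = 1/2 * sin (y \<bullet> (v + u)) + (-1/2) * sin (y \<bullet> (v - u))" for y v u :: 'h
      by (simp_all add: inner_add_right inner_diff_right cos_add cos_diff sin_add sin_diff field_simps)
    have forms: "\<exists>v. f = (\<lambda>y. cos (y \<bullet> v)) \<or> f = (\<lambda>y. sin (y \<bullet> v))" if "f \<in> F" for f
      using that unfolding F_def
      by (elim UnE rangeE) (rule exI, erule disjI1, rule exI, erule disjI2)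
    show "(\<lambda>y. f y * g y) \<in> bounded_class F" if f: "f \<in> F" and g: "g \<in> F" for f g
    proof -
      obtain v where v: "f = (\<lambda>y. cos (y \<bullet> v)) \<or> f = (\<lambda>y. sin (y \<bullet> v))"
        using forms[OF f] by (rule exE)
      obtain u where "g = (\<lambda>y. cos (y \<bullet> u)) \<or> g = (\<lambda>y. sin (y \<bullet> u))"
        using forms[OF g] by (rule exE)
      with v show ?thesis
        by (elim disjE; hypsubst; simp only: cc ss sc cs; intro bounded_class.add cos_in sin_in)
    qed
  qed
  have "sets borel \<subseteq> F.class_sets"
  proof (rule sets_borel_subset_of_halfspaces[OF F.sigma_algebra_class_sets])
    fix v :: 'h and c :: real
    \<comment> \<open>Linear functionals are unbounded and so lie outside the class, but they are
      measurable as limits of \<open>n * sin (y \<bullet> v / n)\<close>, which is the derivative of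
      sine at 0.\<close>
    have "(\<lambda>y. y \<bullet> v) \<in> borel_measurable (sigma UNIV F.class_sets)"
    proof (rule borel_measurable_LIMSEQ_real)
      show "(\<lambda>y. real (Suc n) * sin (y \<bullet> ((1 / real (Suc n)) *\<^sub>R v))) \<in> borel_measurable (sigma UNIV F.class_sets)" for n
        by (intro F.class_measurable bounded_class.scale bounded_class.base)
          (unfold F_def, rule UnI2, rule rangeI)
      show "(\<lambda>n. real (Suc n) * sin (y \<bullet> ((1 / real (Suc n)) *\<^sub>R v))) \<longlonglongrightarrow> y \<bullet> v" for y
      proof -
        have "((\<lambda>h. sin ((y \<bullet> v) * h)) has_real_derivative (y \<bullet> v)) (at 0)"
          by (auto intro!: derivative_eq_intros)
        then have "((\<lambda>h. sin ((y \<bullet> v) * h) / h) \<longlongrightarrow> y \<bullet> v) (at 0)"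
          by (simp add: has_field_derivative_iff)
        moreover have "filterlim (\<lambda>n. inverse (real (Suc n))) (at 0) sequentially"
          using LIMSEQ_inverse_real_of_nat by (simp add: filterlim_at)
        ultimately have "(\<lambda>n. sin ((y \<bullet> v) * inverse (real (Suc n))) / inverse (real (Suc n))) \<longlonglongrightarrow> y \<bullet> v"
          by (rule filterlim_compose)
        then have "(\<lambda>n. real (Suc n) * sin ((y \<bullet> v) / real (Suc n))) \<longlonglongrightarrow> y \<bullet> v"
          by (simp add: divide_inverse mult.commute)
        then show ?thesis by simp
      qed
    qed
    then show "{y. c < y \<bullet> v} \<in> F.class_sets"
      unfolding borel_measurable_iff_greater F.sets_class_sets by simp
  qed
  then have ind: "indicator A \<in> bounded_class F" if "A \<in> sets borel" for A
    using that by (auto simp: F.class_sets_def)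
  \<comment> \<open>Absorbing the weight into the measure gives two finite measures to which
    \<open>bounded_class_integral\<close> applies; being positive everywhere, the weight can be
    divided out again.\<close>
  define dens where "dens \<kappa> = density \<kappa> (\<lambda>y. ennreal (?w y))" for \<kappa>
  have dens_sets: "sets (dens \<kappa>) = sets \<kappa>" for \<kappa> by (simp add: dens_def)
  have meas: "f \<in> borel_measurable \<kappa>" if "f \<in> borel_measurable borel" "sets \<kappa> = sets borel"
    for f :: "'h \<Rightarrow> real" and \<kappa>
    using that by (simp cong: measurable_cong_sets)
  have dens_fin: "finite_measure (dens \<kappa>)" if "finite_measure \<kappa>" "sets \<kappa> = sets borel" for \<kappa>
  proof (rule finite_measureI)
    interpret finite_measure \<kappa> by fact
    have "emeasure (dens \<kappa>) (space (dens \<kappa>)) = (\<integral>\<^sup>+y. ennreal (?w y) \<partial>\<kappa>)"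
      unfolding dens_def using meas[OF w_meas that(2)]
      by (simp add: emeasure_density cong: nn_integral_cong)
    also have "\<dots> \<le> (\<integral>\<^sup>+y. 1 \<partial>\<kappa>)" using w1 by (intro nn_integral_mono) auto
    also have "\<dots> < \<infinity>" by (simp add: less_top[symmetric])
    finally show "emeasure (dens \<kappa>) (space (dens \<kappa>)) \<noteq> \<infinity>" by simp
  qed
  have F_meas: "f \<in> borel_measurable borel" if "f \<in> F" for f
    using that by (auto simp: F_def)
  have dens_int: "(\<integral>y. f y \<partial>dens \<kappa>) = (\<integral>y. ?w y * f y \<partial>\<kappa>)"
    if "f \<in> borel_measurable borel" "sets \<kappa> = sets borel" for f :: "'h \<Rightarrow> real" and \<kappa>
    unfolding dens_def using meas[OF that] meas[OF w_meas that(2)] w0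
    by (subst integral_density) (auto intro: less_imp_le)
  note dens_fin' = dens_fin[OF fin(1) sets(1)] dens_fin[OF fin(2) sets(2)]
  have "dens \<mu> = dens \<nu>"
  proof (rule measure_eqI)
    fix A assume A: "A \<in> sets (dens \<mu>)"
    then have A': "A \<in> sets borel" by (simp add: dens_sets sets)
    have "(\<integral>y. indicator A y \<partial>dens \<mu>) = (\<integral>y. indicator A y \<partial>dens \<nu> :: real)"
    proof (rule bounded_class_integral[OF dens_fin', of borel F])
      show "(\<integral>y. f y \<partial>dens \<mu>) = (\<integral>y. f y \<partial>dens \<nu>)" if "f \<in> F" for f
        using trig[OF that] F_meas[OF that] by (simp add: dens_int sets)
    qed (use F.bounded F_meas ind[OF A'] in \<open>auto simp: dens_sets sets\<close>)
    then have "measure (dens \<mu>) A = measure (dens \<nu>) A"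
      using A' by (simp add: dens_sets sets)
    then show "emeasure (dens \<mu>) A = emeasure (dens \<nu>) A"
      using dens_fin' by (simp add: finite_measure.emeasure_eq_measure)
  qed (simp add: dens_sets sets)
  moreover have "density (dens \<kappa>) (\<lambda>y. ennreal (1 / ?w y)) = \<kappa>" if "sets \<kappa> = sets borel" for \<kappa>
  proof -
    have "density (dens \<kappa>) (\<lambda>y. ennreal (1 / ?w y)) = density \<kappa> (\<lambda>y. ennreal (?w y) * ennreal (1 / ?w y))"
      unfolding dens_def using meas[OF w_meas that] by (intro density_density_eq) auto
    also have "(\<lambda>y. ennreal (?w y) * ennreal (1 / ?w y)) = (\<lambda>_. 1)"
      using w0 by (auto simp: fun_eq_iff less_imp_le less_imp_neq[symmetric] simp flip: ennreal_mult)
    finally show ?thesis by (simp add: density_1)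
  qed
  ultimately show ?thesis using sets by metis
qed

lemma integrally_strictly_pd_gaussian:
  assumes "0 < \<sigma>"
  shows "integrally_strictly_pd borel
    (gaussian_kernel \<sigma> :: 'h::{real_inner, second_countable_topology} \<Rightarrow> 'h \<Rightarrow> real)"
  unfolding integrally_strictly_pd_def
proof (intro conjI allI impI; (elim conjE)?)
  show "pd_kernel borel (gaussian_kernel \<sigma> :: 'h \<Rightarrow> 'h \<Rightarrow> real)" by (rule pd_kernel_gaussian)
  fix \<mu> \<nu> :: "'h measure"
  assume fin: "finite_measure \<mu>" "finite_measure \<nu>" and sets: "sets \<mu> = sets borel" "sets \<nu> = sets borel"
    and neq: "\<mu> \<noteq> \<nu>"
  show "kernel_integrable (gaussian_kernel \<sigma>) \<mu> \<mu>" "kernel_integrable (gaussian_kernel \<sigma>) \<mu> \<nu>"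
    "kernel_integrable (gaussian_kernel \<sigma>) \<nu> \<mu>" "kernel_integrable (gaussian_kernel \<sigma>) \<nu> \<nu>"
    unfolding kernel_integrable_def
    using fin sets by (auto intro: gaussian_kernel_integrable[where f = "\<lambda>y. y"])
  let ?k = "kernel_integral (gaussian_kernel \<sigma>)"
  define B where "B = ?k \<mu> \<mu> - ?k \<mu> \<nu> - ?k \<nu> \<mu> + ?k \<nu> \<nu>"
  show "0 < ?k \<mu> \<mu> - ?k \<mu> \<nu> - ?k \<nu> \<mu> + ?k \<nu> \<nu>"
  proof (rule ccontr)
    assume "\<not> ?thesis"
    then have B: "B \<le> 0" by (simp add: B_def)
    have "(\<integral>y. gaussian_kernel \<sigma> y z \<partial>\<mu>) = (\<integral>y. gaussian_kernel \<sigma> y z \<partial>\<nu>)" for z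
    proof -
      define \<delta> where "\<delta> = (\<integral>y. gaussian_kernel \<sigma> y z \<partial>\<mu>) - (\<integral>y. gaussian_kernel \<sigma> y z \<partial>\<nu>)"
      \<comment> \<open>The choice \<open>t = - \<delta>\<close> minimises the quadratic polynomial
        in \<open>t\<close> and leaves \<open>B - \<delta>\<^sup>2\<close>.\<close>
      have "0 \<le> B + 2 * (- \<delta>) * \<delta> + (- \<delta>)\<^sup>2"
        unfolding B_def \<delta>_def using fin sets by (rule gaussian_kernel_integral_nonneg)
      with B have "\<delta>\<^sup>2 \<le> 0" by (simp add: power2_eq_square)
      then show ?thesis by (simp add: \<delta>_def)
    qed
    then have "\<mu> = \<nu>" by (rule measure_eq_of_gaussian_potential_eq[OF assms fin sets])
    with neq show False ..
  qed
qed

section \<open>The Gram determinant score\<close>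

text \<open>The Blackwell part concerns \<open>strict_blackwell_dominant\<close>, because
  \<open>blackwell_dominant_mutual\<close> exhibits reports dominating each other, on which no score
  can increase both ways. The sort \<open>{real_inner, polish_space}\<close> renders separable
  Hilbert spaces.\<close>

theorem theorem4p9:
  fixes L \<sigma> :: real
    and M :: "'y measure" and K :: "'y \<Rightarrow> 'y \<Rightarrow> real"
    and \<phi> :: "'f::finite \<Rightarrow> real^'k"
    and q :: "'d::finite pmf"
  assumes "L \<ge> 1" and "\<sigma> > 0"
  shows
    "(integrally_strictly_pd M K \<longrightarrow>
        (let \<P> = (P_indep M :: ('d \<Rightarrow> 'y measure) set) in
           score_preserves K \<P> Q_nonperm exact_match \<and>
           score_preserves K \<P> Q_reg strict_blackwell_dominant \<and>
           (\<forall>D. distance_function D \<longrightarrow>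
              score_preserves K \<P> (Q_diag_dom L (1 / (64 * L\<^sup>2 * (real CARD('d))\<^sup>2)))
                (dist_order (1 / (4 * L * distance_ratio D)) D)))) \<and>
     (let G = (gaussian_kernel \<sigma> :: 'h::{real_inner, polish_space} \<Rightarrow> 'h \<Rightarrow> real);
          \<P> = (P_indep borel :: ('d \<Rightarrow> 'h measure) set) in
        integrally_strictly_pd borel G \<and>
        score_preserves G \<P> Q_nonperm exact_match \<and>
        score_preserves G \<P> Q_reg strict_blackwell_dominant \<and>
        (\<forall>D. distance_function D \<longrightarrow>
           score_preserves G \<P> (Q_diag_dom L (1 / (64 * L\<^sup>2 * (real CARD('d))\<^sup>2)))
             (dist_order (1 / (4 * L * distance_ratio D)) D))) \<and>
     (injective_feature_map \<phi> \<longrightarrow>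
        (let F = (\<lambda>y y'. \<phi> y \<bullet> \<phi> y');
             \<P> = (P_indep (count_space UNIV) :: ('d \<Rightarrow> 'f measure) set) in
           score_preserves F \<P> Q_nonperm exact_match \<and>
           score_preserves F \<P> Q_reg strict_blackwell_dominant \<and>
           (\<forall>D. distance_function D \<longrightarrow>
              score_preserves F \<P> (Q_diag_dom L (1 / (64 * L\<^sup>2 * (real CARD('d))\<^sup>2)))
                (dist_order (1 / (4 * L * distance_ratio D)) D)))) \<and>
     ((\<forall>a. pmf q a > 0) \<longrightarrow>
        (let S = (\<lambda>y y' :: real^'d. y \<bullet> y');
             \<P> = P_indep (count_space UNIV) \<inter> P_pseudo_posterior q in
           score_preserves S \<P> Q_nonperm exact_match \<and>
           score_preserves S \<P> Q_reg strict_blackwell_dominant \<and>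
           (\<forall>D. distance_function D \<longrightarrow>
              score_preserves S \<P> (Q_diag_dom L (1 / (64 * L\<^sup>2 * (real CARD('d))\<^sup>2)))
                (dist_order (1 / (4 * L * distance_ratio D)) D))))"
proof -
  note preserve = gram_positive_preserves[OF _ \<open>1 \<le> L\<close>]
  note strict = integrally_strictly_pd_gram_positive
  have gauss: "integrally_strictly_pd borel (gaussian_kernel \<sigma> :: 'h \<Rightarrow> 'h \<Rightarrow> real)"
    using \<open>0 < \<sigma>\<close> by (rule integrally_strictly_pd_gaussian)
  have post: "gram_positive (\<lambda>y y'. y \<bullet> y') P"
    if "\<forall>a. 0 < pmf q a" "P \<in> P_indep (count_space UNIV) \<inter> P_pseudo_posterior q" for P
    using that by (intro pseudo_posterior_gram_positive) auto
  show ?thesis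
    unfolding Let_def
    by (intro conjI impI allI gauss preserve)
      (assumption | erule (1) strict | erule strict[OF gauss]
        | erule (1) strict[OF integrally_strictly_pd_feature_map] | erule (1) post)+
qed

end
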